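(* Let $G$ be a minimal non-sofic group and let $M$ be a maximal normal subgroup of $G$. If $M$ is residually finite and finitely generated, then $M$ is central in $G$ (that is, $M \le Z(G)$). In this case, $G$ is a perfect central extension of a finitely generated non-amenable simple group by $M$; that is, $G=[G,G]$, $M\le Z(G)$, and $G/M$ is a finitely generated non-amenable simple group.
   Context: For $n\ge 1$, the normalized Hamming metric on the symmetric group $S_n$ is $d_{\mathrm{hamm}}(\sigma,\tau)=\frac1n\#\{i:\sigma(i)\ne\tau(i)\}$. A group $G$ is sofic if there exist a set $A$, an ultrafilter $\mathcal U$ on $A$ and a map $\alpha\mapsto n(\alpha)$ from $A$ to the positive integers such that $G$ is isomorphic to a subgroup of the metric ultraproduct $\prod_{\alpha\in A}(S_{n(\alpha)},d_{\mathrm{hamm}})/\mathcal U$, i.e. the quotient of $\prod_{\alpha} S_{n(\alpha)}$ by the normal subgroup of all $(\sigma_\alpha)$ with $\lim_{\alpha\to\mathcal U} d_{\mathrm{hamm}}(\sigma_\alpha,\mathrm{Id})=0$. A group $G$ is minimal non-sofic if $G$ is not sofic but every proper subgroup of $G$ is sofic. It is not assumed that such groups exist. A maximal normal subgroup of $G$ is a proper normal subgroup that is maximal under inclusion among proper normal subgroups of $G$. Amenability is that of discrete groups. *)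

theory Defs
  imports Complex_Main "HOL-Algebra.Sym_Groups" "HOL-Algebra.Product_Groups"
begin

section \<open>Metric ultraproducts of symmetric groups\<close>

definition hamm_dist :: "nat \<Rightarrow> (nat \<Rightarrow> nat) \<Rightarrow> (nat \<Rightarrow> nat) \<Rightarrow> real" where
  "hamm_dist n \<sigma> \<tau> = real (card {i \<in> {1..n}. \<sigma> i \<noteq> \<tau> i}) / real n"

text \<open>An ultrafilter on a set \<open>A\<close> is represented by a filter on the ambient type that contains \<open>A\<close>;
  the sets in it that are contained in \<open>A\<close> are then an ultrafilter on \<open>A\<close>, and every
  ultrafilter on \<open>A\<close> arises in this way.  Principal ultrafilters are allowed.\<close>

definition ultrafilter_on :: "'i set \<Rightarrow> 'i filter \<Rightarrow> bool" where
  "ultrafilter_on A U \<longleftrightarrow> U \<noteq> bot \<and> eventually (\<lambda>\<alpha>. \<alpha> \<in> A) U \<and>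
     (\<forall>P. eventually P U \<or> eventually (\<lambda>\<alpha>. \<not> P \<alpha>) U)"

definition sym_product :: "'i set \<Rightarrow> ('i \<Rightarrow> nat) \<Rightarrow> ('i \<Rightarrow> nat \<Rightarrow> nat) monoid" where
  "sym_product A n = product_group A (\<lambda>\<alpha>. sym_group (n \<alpha>))"

definition null_sequences :: "'i set \<Rightarrow> 'i filter \<Rightarrow> ('i \<Rightarrow> nat) \<Rightarrow> ('i \<Rightarrow> nat \<Rightarrow> nat) set" where
  "null_sequences A U n =
     {\<sigma> \<in> carrier (sym_product A n). ((\<lambda>\<alpha>. hamm_dist (n \<alpha>) (\<sigma> \<alpha>) id) \<longlongrightarrow> 0) U}"

definition sym_ultraproduct ::
    "'i set \<Rightarrow> 'i filter \<Rightarrow> ('i \<Rightarrow> nat) \<Rightarrow> ('i \<Rightarrow> nat \<Rightarrow> nat) set monoid" where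
  "sym_ultraproduct A U n = sym_product A n Mod null_sequences A U n"


section \<open>Sofic groups\<close>

definition sofic_via ::
    "'i set \<Rightarrow> 'i filter \<Rightarrow> ('i \<Rightarrow> nat) \<Rightarrow> ('a, 'b) monoid_scheme \<Rightarrow> bool" where
  "sofic_via A U n G \<longleftrightarrow> ultrafilter_on A U \<and> (\<forall>\<alpha>\<in>A. n \<alpha> > 0) \<and>
     (\<exists>H. subgroup H (sym_ultraproduct A U n) \<and> G \<cong> (sym_ultraproduct A U n)\<lparr>carrier := H\<rparr>)"

text \<open>A HOL definition cannot quantify over the type in which the index set \<open>A\<close> lives.  The sets of
  pairs of a subset of the group and a natural number are enough: by \<open>sofic_viaI\<close> below,
  an embedding into an ultraproduct over an index set in any type whatsoever makes
  the group sofic in the sense of this definition.\<close>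

definition sofic :: "('a, 'b) monoid_scheme \<Rightarrow> bool" where
  "sofic G \<longleftrightarrow> (\<exists>(A :: ('a set \<times> nat) set) U n. sofic_via A U n G)"

definition minimal_non_sofic :: "('a, 'b) monoid_scheme \<Rightarrow> bool" where
  "minimal_non_sofic G \<longleftrightarrow> group G \<and> \<not> sofic G \<and>
     (\<forall>H. subgroup H G \<and> H \<noteq> carrier G \<longrightarrow> sofic (G\<lparr>carrier := H\<rparr>))"


section \<open>Notions from group theory\<close>

definition maximal_normal_subgroup :: "'a set \<Rightarrow> ('a, 'b) monoid_scheme \<Rightarrow> bool" where
  "maximal_normal_subgroup M G \<longleftrightarrow> M \<lhd> G \<and> M \<noteq> carrier G \<and>
     (\<forall>N. N \<lhd> G \<and> N \<noteq> carrier G \<and> M \<subseteq> N \<longrightarrow> N = M)"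

definition residually_finite :: "('a, 'b) monoid_scheme \<Rightarrow> bool" where
  "residually_finite G \<longleftrightarrow>
     (\<forall>x \<in> carrier G - {\<one>\<^bsub>G\<^esub>}. \<exists>N. N \<lhd> G \<and> finite (carrier (G Mod N)) \<and> x \<notin> N)"

definition finitely_generated :: "('a, 'b) monoid_scheme \<Rightarrow> bool" where
  "finitely_generated G \<longleftrightarrow> (\<exists>S. finite S \<and> S \<subseteq> carrier G \<and> generate G S = carrier G)"

definition center :: "('a, 'b) monoid_scheme \<Rightarrow> 'a set" where
  "center G = {z \<in> carrier G. \<forall>g \<in> carrier G. z \<otimes>\<^bsub>G\<^esub> g = g \<otimes>\<^bsub>G\<^esub> z}"

text \<open>The library locale \<open>simple_group\<close> requires \<open>order G > 1\<close>, and the order of an infinite group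
  is 0 there, so that it only covers finite simple groups.\<close>

definition is_simple :: "('a, 'b) monoid_scheme \<Rightarrow> bool" where
  "is_simple G \<longleftrightarrow> group G \<and> carrier G \<noteq> {\<one>\<^bsub>G\<^esub>} \<and>
     (\<forall>N. N \<lhd> G \<longrightarrow> N = carrier G \<or> N = {\<one>\<^bsub>G\<^esub>})"

text \<open>Amenability of a discrete group: a left-invariant finitely additive probability measure
  defined on all subsets.\<close>

definition amenable :: "('a, 'b) monoid_scheme \<Rightarrow> bool" where
  "amenable G \<longleftrightarrow> (\<exists>\<mu> :: 'a set \<Rightarrow> real.
     (\<forall>A. A \<subseteq> carrier G \<longrightarrow> 0 \<le> \<mu> A) \<and>
     \<mu> (carrier G) = 1 \<and>
     (\<forall>A B. A \<subseteq> carrier G \<and> B \<subseteq> carrier G \<and> A \<inter> B = {} \<longrightarrow> \<mu> (A \<union> B) = \<mu> A + \<mu> B) \<and>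
     (\<forall>g A. g \<in> carrier G \<and> A \<subseteq> carrier G \<longrightarrow> \<mu> (g <#\<^bsub>G\<^esub> A) = \<mu> A))"


section \<open>Independence of soficity from the type of the index set\<close>

lemma hamm_dist_nonneg: "0 \<le> hamm_dist n \<sigma> \<tau>"
  by (simp add: hamm_dist_def)

lemma hamm_dist_self [simp]: "hamm_dist n \<sigma> \<sigma> = 0"
  by (simp add: hamm_dist_def)

lemma hamm_dist_commute: "hamm_dist n \<sigma> \<tau> = hamm_dist n \<tau> \<sigma>"
  unfolding hamm_dist_def by (metis (no_types))

lemma hamm_dist_triangle: "hamm_dist n \<sigma> \<rho> \<le> hamm_dist n \<sigma> \<tau> + hamm_dist n \<tau> \<rho>"
proof -
  have "card {i \<in> {1..n}. \<sigma> i \<noteq> \<rho> i}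
      \<le> card ({i \<in> {1..n}. \<sigma> i \<noteq> \<tau> i} \<union> {i \<in> {1..n}. \<tau> i \<noteq> \<rho> i})"
    by (rule card_mono) auto
  also have "\<dots> \<le> card {i \<in> {1..n}. \<sigma> i \<noteq> \<tau> i} + card {i \<in> {1..n}. \<tau> i \<noteq> \<rho> i}"
    by (rule card_Un_le)
  finally have "real (card {i \<in> {1..n}. \<sigma> i \<noteq> \<rho> i})
      \<le> real (card {i \<in> {1..n}. \<sigma> i \<noteq> \<tau> i}) + real (card {i \<in> {1..n}. \<tau> i \<noteq> \<rho> i})"
    by linarith
  then show ?thesis
    unfolding hamm_dist_def by (simp add: divide_right_mono flip: add_divide_distrib)
qed

lemma hamm_dist_left: "inj \<rho> \<Longrightarrow> hamm_dist n (\<rho> \<circ> \<sigma>) (\<rho> \<circ> \<tau>) = hamm_dist n \<sigma> \<tau>"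
  by (simp add: hamm_dist_def inj_eq)

lemma hamm_dist_right:
  assumes "\<rho> permutes {1..n}"
  shows "hamm_dist n (\<sigma> \<circ> \<rho>) (\<tau> \<circ> \<rho>) = hamm_dist n \<sigma> \<tau>"
proof -
  have "bij_betw \<rho> {i \<in> {1..n}. \<sigma> (\<rho> i) \<noteq> \<tau> (\<rho> i)} {i \<in> {1..n}. \<sigma> i \<noteq> \<tau> i}"
    unfolding bij_betw_def
  proof
    show "inj_on \<rho> {i \<in> {1..n}. \<sigma> (\<rho> i) \<noteq> \<tau> (\<rho> i)}"
      using permutes_inj[OF assms] by (rule inj_on_subset) simp
    show "\<rho> ` {i \<in> {1..n}. \<sigma> (\<rho> i) \<noteq> \<tau> (\<rho> i)} = {i \<in> {1..n}. \<sigma> i \<noteq> \<tau> i}"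
    proof (intro equalityI subsetI)
      fix j assume "j \<in> {i \<in> {1..n}. \<sigma> i \<noteq> \<tau> i}"
      moreover obtain i where "j = \<rho> i" using permutes_surj[OF assms] by (metis surjD)
      ultimately show "j \<in> \<rho> ` {i \<in> {1..n}. \<sigma> (\<rho> i) \<noteq> \<tau> (\<rho> i)}"
        using permutes_in_image[OF assms] by auto
    qed (use permutes_in_image[OF assms] in auto)
  qed
  then show ?thesis
    unfolding hamm_dist_def by (simp add: bij_betw_same_card)
qed

lemma group_sym_product: "group (sym_product A n)"
  by (simp add: sym_product_def sym_group_is_group)

lemma sym_product_carrier:
  "\<sigma> \<in> carrier (sym_product A n) \<longleftrightarrow> (\<forall>\<alpha>\<in>A. \<sigma> \<alpha> permutes {1..n \<alpha>}) \<and> \<sigma> \<in> extensional A"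
  by (auto simp: sym_product_def PiE_iff sym_group_carrier)

lemma sym_product_mult: "\<sigma> \<otimes>\<^bsub>sym_product A n\<^esub> \<tau> = (\<lambda>\<alpha>\<in>A. \<sigma> \<alpha> \<circ> \<tau> \<alpha>)"
  by (simp add: sym_product_def sym_group_mult)

lemma sym_product_one: "\<one>\<^bsub>sym_product A n\<^esub> = (\<lambda>\<alpha>\<in>A. id)"
  by (simp add: sym_product_def sym_group_one)

lemma sym_product_inv:
  "\<sigma> \<in> carrier (sym_product A n) \<Longrightarrow> inv\<^bsub>sym_product A n\<^esub> \<sigma> = (\<lambda>\<alpha>\<in>A. inv' (\<sigma> \<alpha>))"
  by (auto simp: sym_product_def PiE_iff sym_group_is_group fun_eq_iff)

lemma hamm_dist_comp_inv:
  assumes "\<tau> permutes {1..n}"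
  shows "hamm_dist n (\<sigma> \<circ> inv' \<tau>) id = hamm_dist n \<sigma> \<tau>"
  using hamm_dist_right[OF permutes_inv[OF assms], of \<sigma> \<tau>] permutes_inv_o(1)[OF assms] by simp

lemma null_diff_iff:
  assumes "ultrafilter_on A U"
    and s: "\<sigma> \<in> carrier (sym_product A n)" and t: "\<tau> \<in> carrier (sym_product A n)"
  shows "\<sigma> \<otimes>\<^bsub>sym_product A n\<^esub> inv\<^bsub>sym_product A n\<^esub> \<tau> \<in> null_sequences A U n \<longleftrightarrow>
    ((\<lambda>\<alpha>. hamm_dist (n \<alpha>) (\<sigma> \<alpha>) (\<tau> \<alpha>)) \<longlongrightarrow> 0) U"
proof -
  interpret P: group "sym_product A n" by (rule group_sym_product)
  have "eventually (\<lambda>\<alpha>. \<alpha> \<in> A) U" using assms(1) by (simp add: ultrafilter_on_def)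
  then have "eventually (\<lambda>\<alpha>. hamm_dist (n \<alpha>)
      ((\<sigma> \<otimes>\<^bsub>sym_product A n\<^esub> inv\<^bsub>sym_product A n\<^esub> \<tau>) \<alpha>) id
      = hamm_dist (n \<alpha>) (\<sigma> \<alpha>) (\<tau> \<alpha>)) U"
    by eventually_elim
      (use t in \<open>simp add: sym_product_inv sym_product_mult sym_product_carrier hamm_dist_comp_inv\<close>)
  then show ?thesis
    using s t by (simp add: null_sequences_def tendsto_cong)
qed

lemma null_iff:
  assumes "\<sigma> \<in> carrier (sym_product A n)"
  shows "\<sigma> \<in> null_sequences A U n \<longleftrightarrow> ((\<lambda>\<alpha>. hamm_dist (n \<alpha>) (\<sigma> \<alpha>) id) \<longlongrightarrow> 0) U"
  using assms by (simp add: null_sequences_def)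

lemma null_sequences_normal:
  assumes U: "ultrafilter_on A U"
  shows "null_sequences A U n \<lhd> sym_product A n"
proof -
  let ?P = "sym_product A n"
  interpret P: group ?P by (rule group_sym_product)
  have A: "eventually (\<lambda>\<alpha>. \<alpha> \<in> A) U" using U by (simp add: ultrafilter_on_def)
  have sub: "null_sequences A U n \<subseteq> carrier ?P" by (auto simp: null_sequences_def)
  have "subgroup (null_sequences A U n) ?P"
  proof (rule P.subgroupI[OF sub])
    have "((\<lambda>\<alpha>. hamm_dist (n \<alpha>) (\<one>\<^bsub>?P\<^esub> \<alpha>) id) \<longlongrightarrow> 0) U"
      by (rule tendsto_eventually, use A in eventually_elim) (simp add: sym_product_one)
    then show "null_sequences A U n \<noteq> {}"
      using null_iff[OF P.one_closed] by blast
  next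
    fix \<sigma> assume s: "\<sigma> \<in> null_sequences A U n"
    with sub have c: "\<sigma> \<in> carrier ?P" by blast
    from s c have "((\<lambda>\<alpha>. hamm_dist (n \<alpha>) (\<sigma> \<alpha>) id) \<longlongrightarrow> 0) U" by (simp add: null_iff)
    moreover have "eventually (\<lambda>\<alpha>. hamm_dist (n \<alpha>) (\<one>\<^bsub>?P\<^esub> \<alpha>) (\<sigma> \<alpha>)
        = hamm_dist (n \<alpha>) (\<sigma> \<alpha>) id) U"
      using A by eventually_elim (simp add: sym_product_one hamm_dist_commute)
    ultimately have "\<one>\<^bsub>?P\<^esub> \<otimes>\<^bsub>?P\<^esub> inv\<^bsub>?P\<^esub> \<sigma> \<in> null_sequences A U n"
      using null_diff_iff[OF U P.one_closed c] by (simp add: tendsto_cong)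
    then show "inv\<^bsub>?P\<^esub> \<sigma> \<in> null_sequences A U n" using c by simp
  next
    fix \<sigma> \<tau> assume s: "\<sigma> \<in> null_sequences A U n" and t: "\<tau> \<in> null_sequences A U n"
    with sub have c: "\<sigma> \<in> carrier ?P" "\<tau> \<in> carrier ?P" by auto
    have lim: "((\<lambda>\<alpha>. hamm_dist (n \<alpha>) (\<tau> \<alpha>) id + hamm_dist (n \<alpha>) (\<sigma> \<alpha>) id) \<longlongrightarrow> 0 + 0) U"
      using s t c by (intro tendsto_add) (simp_all add: null_iff)
    have ev: "eventually (\<lambda>\<alpha>. hamm_dist (n \<alpha>) ((\<sigma> \<otimes>\<^bsub>?P\<^esub> \<tau>) \<alpha>) id
        \<le> hamm_dist (n \<alpha>) (\<tau> \<alpha>) id + hamm_dist (n \<alpha>) (\<sigma> \<alpha>) id) U"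
      using A
    proof eventually_elim
      case (elim \<alpha>)
      have "inj (\<sigma> \<alpha>)" using c elim by (auto simp: sym_product_carrier permutes_inj)
      then have "hamm_dist (n \<alpha>) (\<sigma> \<alpha> \<circ> \<tau> \<alpha>) (\<sigma> \<alpha> \<circ> id) = hamm_dist (n \<alpha>) (\<tau> \<alpha>) id"
        by (rule hamm_dist_left)
      with hamm_dist_triangle[of "n \<alpha>" "\<sigma> \<alpha> \<circ> \<tau> \<alpha>" id "\<sigma> \<alpha>"] elim
      show ?case by (simp add: sym_product_mult)
    qed
    have "((\<lambda>\<alpha>. hamm_dist (n \<alpha>) ((\<sigma> \<otimes>\<^bsub>?P\<^esub> \<tau>) \<alpha>) id) \<longlongrightarrow> 0) U"
      by (rule tendsto_sandwich[OF _ ev tendsto_const]) (use lim in \<open>simp_all add: hamm_dist_nonneg\<close>)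
    then show "\<sigma> \<otimes>\<^bsub>?P\<^esub> \<tau> \<in> null_sequences A U n" using c by (simp add: null_iff)
  qed
  then show ?thesis
  proof (rule P.normal_invI)
    fix x h assume x: "x \<in> carrier ?P" and h: "h \<in> null_sequences A U n"
    with sub have c: "h \<in> carrier ?P" by blast
    from h c have "((\<lambda>\<alpha>. hamm_dist (n \<alpha>) (h \<alpha>) id) \<longlongrightarrow> 0) U" by (simp add: null_iff)
    moreover have "eventually (\<lambda>\<alpha>. hamm_dist (n \<alpha>) ((x \<otimes>\<^bsub>?P\<^esub> h) \<alpha>) (x \<alpha>)
        = hamm_dist (n \<alpha>) (h \<alpha>) id) U"
      using A
    proof eventually_elim
      case (elim \<alpha>)
      have "inj (x \<alpha>)" using x elim by (auto simp: sym_product_carrier permutes_inj)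
      from hamm_dist_left[OF this, of "n \<alpha>" "h \<alpha>" id] elim
      show ?case by (simp add: sym_product_mult)
    qed
    ultimately show "x \<otimes>\<^bsub>?P\<^esub> h \<otimes>\<^bsub>?P\<^esub> inv\<^bsub>?P\<^esub> x \<in> null_sequences A U n"
      using null_diff_iff[OF U P.m_closed[OF x c] x] by (simp add: tendsto_cong)
  qed
qed

lemma sofic_via_iff:
  assumes "group G" and U: "ultrafilter_on A U" and n: "\<forall>\<alpha>\<in>A. n \<alpha> > 0"
  shows "sofic_via A U n G \<longleftrightarrow>
    (\<exists>s \<in> carrier G \<rightarrow> carrier (sym_product A n).
      (\<forall>g\<in>carrier G. \<forall>h\<in>carrier G.
        ((\<lambda>\<alpha>. hamm_dist (n \<alpha>) (s g \<alpha> \<circ> s h \<alpha>) (s (g \<otimes>\<^bsub>G\<^esub> h) \<alpha>)) \<longlongrightarrow> 0) U) \<and>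
      (\<forall>g\<in>carrier G - {\<one>\<^bsub>G\<^esub>}. \<not> ((\<lambda>\<alpha>. hamm_dist (n \<alpha>) (s g \<alpha>) id) \<longlongrightarrow> 0) U))"
    (is "?L \<longleftrightarrow> (\<exists>s \<in> _. ?R s)")
proof -
  let ?P = "sym_product A n" and ?N = "null_sequences A U n" and ?Q = "sym_ultraproduct A U n"
  interpret G: group G by fact
  interpret N: normal ?N ?P by (rule null_sequences_normal[OF U])
  have Q: "?Q = ?P Mod ?N" by (simp add: sym_ultraproduct_def)
  interpret Q: group ?Q unfolding Q by (rule N.factorgroup_is_group)
  have A: "eventually (\<lambda>\<alpha>. \<alpha> \<in> A) U" using U by (simp add: ultrafilter_on_def)
  have Qmult: "(?N #>\<^bsub>?P\<^esub> \<sigma>) \<otimes>\<^bsub>?Q\<^esub> (?N #>\<^bsub>?P\<^esub> \<tau>) = ?N #>\<^bsub>?P\<^esub> (\<sigma> \<otimes>\<^bsub>?P\<^esub> \<tau>)"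
    if "\<sigma> \<in> carrier ?P" "\<tau> \<in> carrier ?P" for \<sigma> \<tau>
    unfolding Q using that by (simp add: FactGroup_def N.rcos_sum)
  have coset_eq: "?N #>\<^bsub>?P\<^esub> \<sigma> = ?N #>\<^bsub>?P\<^esub> \<tau> \<longleftrightarrow>
      ((\<lambda>\<alpha>. hamm_dist (n \<alpha>) (\<sigma> \<alpha>) (\<tau> \<alpha>)) \<longlongrightarrow> 0) U"
    if "\<sigma> \<in> carrier ?P" "\<tau> \<in> carrier ?P" for \<sigma> \<tau>
  proof -
    have "?N #>\<^bsub>?P\<^esub> \<sigma> = ?N #>\<^bsub>?P\<^esub> \<tau> \<longleftrightarrow> \<sigma> \<otimes>\<^bsub>?P\<^esub> inv\<^bsub>?P\<^esub> \<tau> \<in> ?N"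
    proof
      assume "?N #>\<^bsub>?P\<^esub> \<sigma> = ?N #>\<^bsub>?P\<^esub> \<tau>"
      then have "\<sigma> \<in> ?N #>\<^bsub>?P\<^esub> \<tau>"
        using N.rcos_self[OF that(1) N.subgroup_axioms] by simp
      then show "\<sigma> \<otimes>\<^bsub>?P\<^esub> inv\<^bsub>?P\<^esub> \<tau> \<in> ?N"
        using N.rcos_module_imp[OF N.is_group that(2)] by blast
    next
      assume "\<sigma> \<otimes>\<^bsub>?P\<^esub> inv\<^bsub>?P\<^esub> \<tau> \<in> ?N"
      then have "\<sigma> \<in> ?N #>\<^bsub>?P\<^esub> \<tau>"
        using N.rcos_module_rev[OF N.is_group that(2) that(1)] by blast
      then show "?N #>\<^bsub>?P\<^esub> \<sigma> = ?N #>\<^bsub>?P\<^esub> \<tau>"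
        using N.repr_independence[OF _ that(2) N.subgroup_axioms] by simp
    qed
    then show ?thesis using null_diff_iff[OF U that] by simp
  qed
  have mult_lim: "((\<lambda>\<alpha>. hamm_dist (n \<alpha>) ((\<sigma> \<otimes>\<^bsub>?P\<^esub> \<tau>) \<alpha>) (\<rho> \<alpha>)) \<longlongrightarrow> 0) U \<longleftrightarrow>
      ((\<lambda>\<alpha>. hamm_dist (n \<alpha>) (\<sigma> \<alpha> \<circ> \<tau> \<alpha>) (\<rho> \<alpha>)) \<longlongrightarrow> 0) U" for \<sigma> \<tau> \<rho>
    by (rule tendsto_cong, use A in eventually_elim) (simp add: sym_product_mult)
  have one_coset: "\<one>\<^bsub>?Q\<^esub> = ?N #>\<^bsub>?P\<^esub> \<one>\<^bsub>?P\<^esub>"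
    using N.coset_mult_one[OF N.subset] unfolding Q by (simp add: FactGroup_def)
  have one_lim: "((\<lambda>\<alpha>. hamm_dist (n \<alpha>) (\<sigma> \<alpha>) (\<one>\<^bsub>?P\<^esub> \<alpha>)) \<longlongrightarrow> 0) U \<longleftrightarrow>
      ((\<lambda>\<alpha>. hamm_dist (n \<alpha>) (\<sigma> \<alpha>) id) \<longlongrightarrow> 0) U" for \<sigma>
    by (rule tendsto_cong, use A in eventually_elim) (simp add: sym_product_one)
  show ?thesis
  proof
    assume ?L
    then obtain H \<phi> where H: "subgroup H ?Q" and phi: "\<phi> \<in> iso G (?Q\<lparr>carrier := H\<rparr>)"
      by (auto simp: sofic_via_def is_iso_def)
    have HQ: "H \<subseteq> carrier ?Q" using H by (rule subgroup.subset)
    have "\<phi> g \<in> carrier ?Q" if "g \<in> carrier G" for g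
      using phi HQ that by (auto simp: iso_def hom_def)
    then have "\<forall>g\<in>carrier G. \<exists>\<sigma>\<in>carrier ?P. \<phi> g = ?N #>\<^bsub>?P\<^esub> \<sigma>"
      unfolding Q by (simp add: FactGroup_def RCOSETS_def)
    then obtain s where s: "\<And>g. g \<in> carrier G \<Longrightarrow> s g \<in> carrier ?P"
        and ps: "\<And>g. g \<in> carrier G \<Longrightarrow> \<phi> g = ?N #>\<^bsub>?P\<^esub> s g" by metis
    have mult: "\<phi> (g \<otimes>\<^bsub>G\<^esub> h) = \<phi> g \<otimes>\<^bsub>?Q\<^esub> \<phi> h" if "g \<in> carrier G" "h \<in> carrier G" for g h
      using phi that by (auto simp: iso_def hom_def)
    have "?R s"
    proof (intro conjI ballI)
      fix g h assume g: "g \<in> carrier G" and h: "h \<in> carrier G"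
      have "?N #>\<^bsub>?P\<^esub> (s g \<otimes>\<^bsub>?P\<^esub> s h) = ?N #>\<^bsub>?P\<^esub> s (g \<otimes>\<^bsub>G\<^esub> h)"
        using mult[OF g h] g h s by (simp add: ps Qmult)
      then show "((\<lambda>\<alpha>. hamm_dist (n \<alpha>) (s g \<alpha> \<circ> s h \<alpha>) (s (g \<otimes>\<^bsub>G\<^esub> h) \<alpha>)) \<longlongrightarrow> 0) U"
        using g h s by (simp add: coset_eq mult_lim)
    next
      fix g assume g: "g \<in> carrier G - {\<one>\<^bsub>G\<^esub>}"
      have "\<phi> \<one>\<^bsub>G\<^esub> \<otimes>\<^bsub>?Q\<^esub> \<phi> \<one>\<^bsub>G\<^esub> = \<phi> \<one>\<^bsub>G\<^esub>" using mult[of "\<one>\<^bsub>G\<^esub>" "\<one>\<^bsub>G\<^esub>"] by simp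
      moreover have "\<phi> \<one>\<^bsub>G\<^esub> \<in> carrier ?Q" using phi HQ by (auto simp: iso_def hom_def)
      ultimately have one: "\<phi> \<one>\<^bsub>G\<^esub> = \<one>\<^bsub>?Q\<^esub>" by (simp add: Q.r_cancel_one)
      have "inj_on \<phi> (carrier G)" using phi by (simp add: iso_def bij_betw_def)
      then have "\<phi> g \<noteq> \<phi> \<one>\<^bsub>G\<^esub>" using g by (auto dest: inj_onD)
      then show "\<not> ((\<lambda>\<alpha>. hamm_dist (n \<alpha>) (s g \<alpha>) id) \<longlongrightarrow> 0) U"
        using g s by (simp add: one ps one_coset coset_eq one_lim)
    qed
    with s show "\<exists>s \<in> carrier G \<rightarrow> carrier ?P. ?R s" by blast
  next
    assume "\<exists>s \<in> carrier G \<rightarrow> carrier ?P. ?R s"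
    then obtain s where s: "\<And>g. g \<in> carrier G \<Longrightarrow> s g \<in> carrier ?P" and R: "?R s" by blast
    define \<phi> where "\<phi> g = ?N #>\<^bsub>?P\<^esub> s g" for g
    have hom: "\<phi> \<in> hom G ?Q"
    proof (rule homI)
      fix g assume "g \<in> carrier G"
      then show "\<phi> g \<in> carrier ?Q"
        unfolding Q \<phi>_def using s by (auto simp: FactGroup_def RCOSETS_def)
    next
      fix g h assume g: "g \<in> carrier G" and h: "h \<in> carrier G"
      have "?N #>\<^bsub>?P\<^esub> (s g \<otimes>\<^bsub>?P\<^esub> s h) = ?N #>\<^bsub>?P\<^esub> s (g \<otimes>\<^bsub>G\<^esub> h)"
        using R g h s by (simp add: coset_eq mult_lim)
      then show "\<phi> (g \<otimes>\<^bsub>G\<^esub> h) = \<phi> g \<otimes>\<^bsub>?Q\<^esub> \<phi> h"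
        using g h s by (simp add: \<phi>_def Qmult)
    qed
    interpret hom: group_hom G ?Q \<phi>
      by unfold_locales (rule hom)
    have "g = \<one>\<^bsub>G\<^esub>" if g: "g \<in> carrier G" "\<phi> g = \<one>\<^bsub>?Q\<^esub>" for g
    proof (rule ccontr)
      assume "g \<noteq> \<one>\<^bsub>G\<^esub>"
      with g R have "\<not> ((\<lambda>\<alpha>. hamm_dist (n \<alpha>) (s g \<alpha>) id) \<longlongrightarrow> 0) U" by blast
      with g s show False by (simp add: \<phi>_def one_coset coset_eq one_lim)
    qed
    then have "inj_on \<phi> (carrier G)"
      by (subst hom.inj_on_one_iff) blast
    then have "\<phi> \<in> iso G (?Q\<lparr>carrier := \<phi> ` carrier G\<rparr>)"
      using hom by (auto simp: iso_def hom_def bij_betw_def)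
    moreover have "subgroup (\<phi> ` carrier G) ?Q"
      by (rule hom.img_is_subgroup)
    ultimately show ?L
      using U n by (auto simp: sofic_via_def is_iso_def)
  qed
qed

lemma ex_ultrafilter_le:
  assumes "F \<noteq> bot"
  shows "\<exists>U \<le> F. U \<noteq> bot \<and> (\<forall>P. eventually P U \<or> eventually (\<lambda>x. \<not> P x) U)"
proof -
  define \<F> where "\<F> = {{P. eventually P U} | U. U \<noteq> bot \<and> U \<le> F}"
  have "\<exists>M\<in>\<F>. \<forall>X\<in>\<F>. M \<subseteq> X \<longrightarrow> X = M"
  proof (rule subset_Zorn_nonempty)
    show "\<F> \<noteq> {}" using assms by (auto simp: \<F>_def)
  next
    fix \<C> assume ne: "\<C> \<noteq> {}" and chain: "subset.chain \<F> \<C>"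
    have sub: "\<C> \<subseteq> \<F>" and lin: "\<And>X Y. X \<in> \<C> \<Longrightarrow> Y \<in> \<C> \<Longrightarrow> X \<subseteq> Y \<or> Y \<subseteq> X"
      using chain by (auto simp: subset_chain_def)
    have memb: "\<exists>U. X = {P. eventually P U} \<and> U \<noteq> bot \<and> U \<le> F" if "X \<in> \<C>" for X
      using sub that by (auto simp: \<F>_def)
    have filt: "is_filter (\<lambda>P. P \<in> \<Union>\<C>)"
    proof
      show "(\<lambda>x. True) \<in> \<Union>\<C>" using ne memb by fastforce
    next
      fix P Q assume "P \<in> \<Union>\<C>" "Q \<in> \<Union>\<C>"
      then obtain X where "X \<in> \<C>" "P \<in> X" "Q \<in> X" using lin by blast
      moreover from this memb obtain U where "X = {P. eventually P U}" by blast
      ultimately show "(\<lambda>x. P x \<and> Q x) \<in> \<Union>\<C>" using eventually_conj by blast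
    next
      fix P Q assume PQ: "\<forall>x. P x \<longrightarrow> Q x" and "P \<in> \<Union>\<C>"
      then obtain X where "X \<in> \<C>" "P \<in> X" by blast
      moreover from this memb obtain U where "X = {P. eventually P U}" by blast
      ultimately show "Q \<in> \<Union>\<C>" using eventually_mono PQ by blast
    qed
    define V where "V = Abs_filter (\<lambda>P. P \<in> \<Union>\<C>)"
    have V: "eventually P V \<longleftrightarrow> P \<in> \<Union>\<C>" for P
      unfolding V_def by (rule eventually_Abs_filter[OF filt])
    have "V \<noteq> bot"
    proof
      assume "V = bot"
      then have "(\<lambda>_. False) \<in> \<Union>\<C>" unfolding V[symmetric] by simp
      then show False using memb by (fastforce simp: trivial_limit_def)
    qed
    moreover have "V \<le> F"
    proof (rule filter_leI)
      fix P assume P: "eventually P F"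
      obtain X where "X \<in> \<C>" using ne by blast
      with memb obtain U where "X = {P. eventually P U}" "U \<le> F" by blast
      with P have "P \<in> X" by (simp add: le_filter_def)
      with \<open>X \<in> \<C>\<close> show "eventually P V" unfolding V by blast
    qed
    moreover have "\<Union>\<C> = {P. eventually P V}" by (auto simp: V)
    ultimately show "\<Union>\<C> \<in> \<F>" unfolding \<F>_def by blast
  qed
  then obtain U where U: "U \<noteq> bot" "U \<le> F"
    and max: "\<And>V. V \<noteq> bot \<Longrightarrow> V \<le> U \<Longrightarrow> {P. eventually P V} = {P. eventually P U}"
  proof -
    assume *: "\<And>U. U \<noteq> bot \<Longrightarrow> U \<le> F \<Longrightarrow>
      (\<And>V. V \<noteq> bot \<Longrightarrow> V \<le> U \<Longrightarrow> {P. eventually P V} = {P. eventually P U}) \<Longrightarrow> thesis"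
    assume "\<exists>M\<in>\<F>. \<forall>X\<in>\<F>. M \<subseteq> X \<longrightarrow> X = M"
    then obtain U where U: "U \<noteq> bot" "U \<le> F"
      and m: "\<forall>X\<in>\<F>. {P. eventually P U} \<subseteq> X \<longrightarrow> X = {P. eventually P U}"
      by (auto simp: \<F>_def)
    show thesis
    proof (rule *[OF U])
      fix V assume V: "V \<noteq> bot" "V \<le> U"
      then have "{P. eventually P V} \<in> \<F>" using U(2) order_trans unfolding \<F>_def by blast
      moreover have "{P. eventually P U} \<subseteq> {P. eventually P V}"
        using V(2) by (auto simp: le_filter_def)
      ultimately show "{P. eventually P V} = {P. eventually P U}" using m by blast
    qed
  qed
  have "eventually P U \<or> eventually (\<lambda>x. \<not> P x) U" for P
  proof (rule disjCI)
    assume "\<not> eventually (\<lambda>x. \<not> P x) U"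
    then have "inf U (principal {x. P x}) \<noteq> bot"
      by (simp add: trivial_limit_def eventually_inf_principal)
    then have "{Q. eventually Q (inf U (principal {x. P x}))} = {Q. eventually Q U}"
      by (rule max) simp
    moreover have "eventually P (inf U (principal {x. P x}))"
      by (simp add: eventually_inf_principal)
    ultimately show "eventually P U" by blast
  qed
  with U show ?thesis by blast
qed

theorem sofic_viaI:
  fixes G :: "('a, 'b) monoid_scheme" and A :: "'i set"
  assumes "group G" and via: "sofic_via A U n G"
  shows "sofic G"
proof -
  interpret G: group G by fact
  have U: "ultrafilter_on A U" and n: "\<forall>\<alpha>\<in>A. n \<alpha> > 0"
    using via by (auto simp: sofic_via_def)
  have A: "eventually (\<lambda>\<alpha>. \<alpha> \<in> A) U" and bot: "U \<noteq> bot"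
    and ultra: "\<And>P. eventually P U \<or> eventually (\<lambda>\<alpha>. \<not> P \<alpha>) U"
    using U by (auto simp: ultrafilter_on_def)
  obtain s where s: "\<And>g. g \<in> carrier G \<Longrightarrow> s g \<in> carrier (sym_product A n)"
    and mult: "\<And>g h. g \<in> carrier G \<Longrightarrow> h \<in> carrier G \<Longrightarrow>
        ((\<lambda>\<alpha>. hamm_dist (n \<alpha>) (s g \<alpha> \<circ> s h \<alpha>) (s (g \<otimes>\<^bsub>G\<^esub> h) \<alpha>)) \<longlongrightarrow> 0) U"
    and sep: "\<And>g. g \<in> carrier G - {\<one>\<^bsub>G\<^esub>} \<Longrightarrow>
        \<not> ((\<lambda>\<alpha>. hamm_dist (n \<alpha>) (s g \<alpha>) id) \<longlongrightarrow> 0) U"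
    using via sofic_via_iff[OF \<open>group G\<close> U n] by blast
  have "\<exists>e>0. eventually (\<lambda>\<alpha>. e \<le> hamm_dist (n \<alpha>) (s g \<alpha>) id) U"
    if g: "g \<in> carrier G - {\<one>\<^bsub>G\<^esub>}" for g
  proof -
    obtain e where "e > 0"
      and "\<not> eventually (\<lambda>\<alpha>. dist (hamm_dist (n \<alpha>) (s g \<alpha>) id) 0 < e) U"
      using sep[OF g] unfolding tendsto_iff by blast
    with ultra[of "\<lambda>\<alpha>. dist (hamm_dist (n \<alpha>) (s g \<alpha>) id) 0 < e"]
    have "eventually (\<lambda>\<alpha>. e \<le> hamm_dist (n \<alpha>) (s g \<alpha>) id) U"
      by (simp add: not_less hamm_dist_nonneg)
    with \<open>e > 0\<close> show ?thesis by blast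
  qed
  then obtain e where e: "\<And>g. g \<in> carrier G - {\<one>\<^bsub>G\<^esub>} \<Longrightarrow> e g > 0"
    and sep': "\<And>g. g \<in> carrier G - {\<one>\<^bsub>G\<^esub>} \<Longrightarrow>
      eventually (\<lambda>\<alpha>. e g \<le> hamm_dist (n \<alpha>) (s g \<alpha>) id) U"
    by metis
  define B :: "('a set \<times> nat) set" where "B = {(F, k). finite F \<and> F \<subseteq> carrier G}"
  have "\<exists>\<alpha>\<in>A. (\<forall>g\<in>F. \<forall>h\<in>F.
        hamm_dist (n \<alpha>) (s g \<alpha> \<circ> s h \<alpha>) (s (g \<otimes>\<^bsub>G\<^esub> h) \<alpha>) < 1 / Suc k) \<and>
      (\<forall>g\<in>F - {\<one>\<^bsub>G\<^esub>}. e g \<le> hamm_dist (n \<alpha>) (s g \<alpha>) id)"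
    if "(F, k) \<in> B" for F k
  proof -
    from that have F: "finite F" "F \<subseteq> carrier G" by (auto simp: B_def)
    have "eventually (\<lambda>\<alpha>. hamm_dist (n \<alpha>) (s g \<alpha> \<circ> s h \<alpha>) (s (g \<otimes>\<^bsub>G\<^esub> h) \<alpha>) < 1 / Suc k) U"
      if "g \<in> F" "h \<in> F" for g h
      using order_tendstoD(2)[OF mult, of g h "1 / Suc k"] that F by auto
    then have "eventually (\<lambda>\<alpha>. \<forall>g\<in>F. \<forall>h\<in>F.
        hamm_dist (n \<alpha>) (s g \<alpha> \<circ> s h \<alpha>) (s (g \<otimes>\<^bsub>G\<^esub> h) \<alpha>) < 1 / Suc k) U"
      using F(1) by (simp add: eventually_ball_finite)
    moreover have "eventually (\<lambda>\<alpha>. \<forall>g\<in>F - {\<one>\<^bsub>G\<^esub>}. e g \<le> hamm_dist (n \<alpha>) (s g \<alpha>) id) U"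
      using F sep' by (intro eventually_ball_finite) auto
    ultimately have "eventually (\<lambda>\<alpha>. \<alpha> \<in> A \<and> (\<forall>g\<in>F. \<forall>h\<in>F.
        hamm_dist (n \<alpha>) (s g \<alpha> \<circ> s h \<alpha>) (s (g \<otimes>\<^bsub>G\<^esub> h) \<alpha>) < 1 / Suc k) \<and>
      (\<forall>g\<in>F - {\<one>\<^bsub>G\<^esub>}. e g \<le> hamm_dist (n \<alpha>) (s g \<alpha>) id)) U"
      using A by eventually_elim blast
    then show ?thesis using eventually_happens bot by blast
  qed
  then have "\<forall>b\<in>B. \<exists>\<alpha>. \<alpha> \<in> A \<and> (\<forall>g\<in>fst b. \<forall>h\<in>fst b.
        hamm_dist (n \<alpha>) (s g \<alpha> \<circ> s h \<alpha>) (s (g \<otimes>\<^bsub>G\<^esub> h) \<alpha>) < 1 / Suc (snd b)) \<and>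
      (\<forall>g\<in>fst b - {\<one>\<^bsub>G\<^esub>}. e g \<le> hamm_dist (n \<alpha>) (s g \<alpha>) id)"
    by (metis prod.collapse)
  then obtain a where aA: "\<And>b. b \<in> B \<Longrightarrow> a b \<in> A"
    and amult: "\<And>b g h. b \<in> B \<Longrightarrow> g \<in> fst b \<Longrightarrow> h \<in> fst b \<Longrightarrow> hamm_dist (n (a b))
        (s g (a b) \<circ> s h (a b)) (s (g \<otimes>\<^bsub>G\<^esub> h) (a b)) < 1 / Suc (snd b)"
    and asep: "\<And>b g. b \<in> B \<Longrightarrow> g \<in> fst b - {\<one>\<^bsub>G\<^esub>} \<Longrightarrow>
        e g \<le> hamm_dist (n (a b)) (s g (a b)) id"
    unfolding bchoice_iff by metis
  define up where "up b = {c \<in> B. fst b \<subseteq> fst c \<and> snd b \<le> snd c}" for b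
  define T where "T = (INF b\<in>B. principal (up b))"
  have ne: "B \<noteq> {}" by (auto simp: B_def)
  have T: "eventually P T \<longleftrightarrow> (\<exists>b\<in>B. \<forall>c\<in>up b. P c)" for P
    unfolding T_def
  proof (subst eventually_INF_base[OF ne])
    fix b c assume "b \<in> B" "c \<in> B"
    then have "(fst b \<union> fst c, max (snd b) (snd c)) \<in> B" by (auto simp: B_def)
    then show "\<exists>x\<in>B. principal (up x) \<le> inf (principal (up b)) (principal (up c))"
      by (rule bexI[rotated]) (auto simp: up_def)
  qed (simp add: eventually_principal)
  have "b \<in> up b" if "b \<in> B" for b using that by (simp add: up_def)
  then have "T \<noteq> bot" unfolding trivial_limit_def T by blast
  then obtain V where VT: "V \<le> T" and V: "V \<noteq> bot"
    "\<forall>P. eventually P V \<or> eventually (\<lambda>x. \<not> P x) V"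
    using ex_ultrafilter_le by blast
  have evV: "eventually P V" if "b \<in> B" "\<And>c. c \<in> up b \<Longrightarrow> P c" for b P
    by (rule filter_leD[OF VT]) (unfold T, use that in blast)
  have BV: "eventually (\<lambda>b. b \<in> B) V"
    by (rule evV[of "({}, 0)"]) (auto simp: B_def up_def)
  have uV: "ultrafilter_on B V" using V BV by (simp add: ultrafilter_on_def)
  define t where "t g = (\<lambda>b\<in>B. s g (a b))" for g
  have "sofic_via B V (n \<circ> a) G"
  proof (subst sofic_via_iff[OF \<open>group G\<close> uV])
    show "\<forall>b\<in>B. (n \<circ> a) b > 0" using n aA by simp
    have "t \<in> carrier G \<rightarrow> carrier (sym_product B (n \<circ> a))"
      using s aA by (auto simp: sym_product_carrier t_def)
    moreover have "((\<lambda>b. hamm_dist ((n \<circ> a) b) (t g b \<circ> t h b) (t (g \<otimes>\<^bsub>G\<^esub> h) b)) \<longlongrightarrow> 0) V"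
      if "g \<in> carrier G" "h \<in> carrier G" for g h
      unfolding tendsto_iff
    proof (intro allI impI)
      fix r :: real assume "0 < r"
      then obtain k where k: "1 / Suc k < r" using nat_approx_posE by metis
      show "eventually (\<lambda>b.
        dist (hamm_dist ((n \<circ> a) b) (t g b \<circ> t h b) (t (g \<otimes>\<^bsub>G\<^esub> h) b)) 0 < r) V"
      proof (rule evV[of "({g, h}, k)"])
        show "({g, h}, k) \<in> B" using that by (simp add: B_def)
        fix c assume c: "c \<in> up ({g, h}, k)"
        then have "1 / Suc (snd c) \<le> 1 / Suc k" by (auto simp: up_def frac_le)
        moreover have "hamm_dist (n (a c)) (s g (a c) \<circ> s h (a c)) (s (g \<otimes>\<^bsub>G\<^esub> h) (a c))
            < 1 / Suc (snd c)"
          using c by (intro amult) (auto simp: up_def)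
        ultimately show "dist (hamm_dist ((n \<circ> a) c) (t g c \<circ> t h c) (t (g \<otimes>\<^bsub>G\<^esub> h) c)) 0 < r"
          using c k by (simp add: up_def t_def hamm_dist_nonneg)
      qed
    qed
    moreover have "\<not> ((\<lambda>b. hamm_dist ((n \<circ> a) b) (t g b) id) \<longlongrightarrow> 0) V"
      if g: "g \<in> carrier G - {\<one>\<^bsub>G\<^esub>}" for g
    proof
      assume "((\<lambda>b. hamm_dist ((n \<circ> a) b) (t g b) id) \<longlongrightarrow> 0) V"
      from order_tendstoD(2)[OF this e[OF g]]
      have "eventually (\<lambda>b. hamm_dist ((n \<circ> a) b) (t g b) id < e g) V" .
      moreover have "eventually (\<lambda>b. e g \<le> hamm_dist ((n \<circ> a) b) (t g b) id) V"
      proof (rule evV[of "({g}, 0)"])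
        show "({g}, 0) \<in> B" using g by (simp add: B_def)
        fix c assume "c \<in> up ({g}, 0)"
        then show "e g \<le> hamm_dist ((n \<circ> a) c) (t g c) id"
          using asep[of c g] g by (auto simp: up_def t_def)
      qed
      ultimately have "eventually (\<lambda>b. False) V" by eventually_elim simp
      then show False using V(1) by (simp add: trivial_limit_def)
    qed
    ultimately show "\<exists>s\<in>carrier G \<rightarrow> carrier (sym_product B (n \<circ> a)).
      (\<forall>g\<in>carrier G. \<forall>h\<in>carrier G.
        ((\<lambda>\<alpha>. hamm_dist ((n \<circ> a) \<alpha>) (s g \<alpha> \<circ> s h \<alpha>) (s (g \<otimes>\<^bsub>G\<^esub> h) \<alpha>)) \<longlongrightarrow> 0) V) \<and>
      (\<forall>g\<in>carrier G - {\<one>\<^bsub>G\<^esub>}. \<not> ((\<lambda>\<alpha>. hamm_dist ((n \<circ> a) \<alpha>) (s g \<alpha>) id) \<longlongrightarrow> 0) V)"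
      by blast
  qed
  then show ?thesis unfolding sofic_def by blast
qed

end

theory Submission
  imports Defs "HOL-Algebra.Left_Coset" "HOL-Algebra.Multiplicative_Group"
begin

text \<open>A group \<open>G\<close> containing a sofic subgroup \<open>H\<close> is sofic if the cosets of \<open>H\<close> admit Folner sets \<open>F\<close>:
  approximations of \<open>H\<close> on \<open>X\<close> induce approximations of \<open>G\<close> on \<open>F \<times> X\<close>.  Hence a minimal non-sofic
  group \<open>G\<close> has no proper subgroup of finite index and no amenable quotient by a proper normal
  subgroup, and it is finitely generated since soficity is a local property.

  If \<open>N\<close> is normal of finite index in \<open>M\<close>, then the \<open>c\<close> in \<open>G\<close> with \<open>c\<inverse> m c \<in> N m\<close> for all \<open>m\<close> in \<open>M\<close>
  form a subgroup of finite index because \<open>M\<close> is finitely generated.  So this subgroup is \<open>G\<close>, all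
  commutators of \<open>M\<close> and \<open>G\<close> lie in \<open>N\<close>, and residual finiteness makes \<open>M\<close> central.  If \<open>G\<close> were not
  perfect, a maximal normal subgroup above the derived subgroup would have a simple abelian, hence
  finite, quotient.\<close>

section \<open>Approximations on finite sets\<close>

text \<open>The set \<open>X\<close> may have any type, so that products can carry approximations.
  Only defect and separation refer to \<open>E\<close>; being a permutation is asked of all group
  elements, because products of elements of \<open>E\<close> may lie outside
  \<open>E\<close>.\<close>

definition sofic_approx ::
    "('a, 'b) monoid_scheme \<Rightarrow> 'a set \<Rightarrow> real \<Rightarrow> real \<Rightarrow> 'x set \<Rightarrow> ('a \<Rightarrow> 'x \<Rightarrow> 'x) \<Rightarrow> bool" where
  "sofic_approx G E \<epsilon> \<delta> X s \<longleftrightarrow> finite X \<and> X \<noteq> {} \<and> (\<forall>g\<in>carrier G. s g permutes X) \<and>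
     (\<forall>g\<in>E. \<forall>h\<in>E. real (card {x \<in> X. s g (s h x) \<noteq> s (g \<otimes>\<^bsub>G\<^esub> h) x}) \<le> \<epsilon> * card X) \<and>
     (\<forall>g\<in>E - {\<one>\<^bsub>G\<^esub>}. \<delta> * card X \<le> real (card {x \<in> X. s g x \<noteq> x}))"

lemma card_Collect_bij_betw:
  assumes b: "bij_betw b Y X" and "\<And>y. y \<in> Y \<Longrightarrow> P y \<longleftrightarrow> Q (b y)"
  shows "card {y \<in> Y. P y} = card {x \<in> X. Q x}"
proof -
  have "bij_betw b {y \<in> Y. P y} {x \<in> X. Q x}"
    unfolding bij_betw_def
  proof
    show "inj_on b {y \<in> Y. P y}" using b by (auto simp: bij_betw_def inj_on_def)
    show "b ` {y \<in> Y. P y} = {x \<in> X. Q x}"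
      using b assms(2) by (force simp: bij_betw_def)
  qed
  then show ?thesis by (rule bij_betw_same_card)
qed

text \<open>Conjugating by an enumeration of \<open>X\<close> preserves all the counts. This leads
  back from products to the initial segments on which \<open>sym_group\<close> acts.\<close>

lemma sofic_approx_transfer:
  fixes X :: "'x set"
  assumes G: "group G" and E: "E \<subseteq> carrier G" and a: "sofic_approx G E \<epsilon> \<delta> X s"
  shows "\<exists>t. sofic_approx G E \<epsilon> \<delta> {1..card X} t"
proof -
  interpret group G by fact
  have X: "finite X" "X \<noteq> {}" and s: "\<And>g. g \<in> carrier G \<Longrightarrow> s g permutes X"
    using a by (auto simp: sofic_approx_def)
  define Y where "Y = {1..card X}"
  have Y: "card Y = card X" "finite Y" "Y \<noteq> {}"
    using X by (auto simp: Y_def Suc_le_eq card_gt_0_iff)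
  obtain b where b: "bij_betw b Y X"
    using ex_bij_betw_nat_finite_1[OF X(1)] unfolding Y_def by blast
  define c where "c = inv_into Y b"
  have c: "bij_betw c X Y" unfolding c_def by (rule bij_betw_inv_into[OF b])
  have bc: "b (c x) = x" if "x \<in> X" for x
    using b that by (simp add: c_def bij_betw_inv_into_right)
  have bX: "b y \<in> X" if "y \<in> Y" for y using bij_betwE[OF b] that by blast
  define t where "t g y = (if y \<in> Y then c (s g (b y)) else y)" for g y
  have tX: "t g permutes Y" if "g \<in> carrier G" for g
  proof (rule bij_imp_permutes)
    have "bij_betw (c \<circ> (s g \<circ> b)) Y Y"
      by (rule bij_betw_trans[OF bij_betw_trans[OF b permutes_imp_bij[OF s[OF that]]] c])
    then show "bij_betw (t g) Y Y"
      by (rule bij_betw_cong[THEN iffD1, rotated]) (simp add: t_def)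
  qed (auto simp: t_def)
  have sX: "s g x \<in> X" if "g \<in> carrier G" "x \<in> X" for g x
    using s that by (simp add: permutes_in_image)
  have bt: "b (t g y) = s g (b y)" if "g \<in> carrier G" "y \<in> Y" for g y
    using that bX sX bc by (auto simp: t_def)
  have t_mem: "t g y \<in> Y" if "g \<in> carrier G" "y \<in> Y" for g y
    using permutes_in_image[OF tX[OF that(1)]] that(2) by simp
  have eq_iff: "y = z \<longleftrightarrow> b y = b z" if "y \<in> Y" "z \<in> Y" for y z
    using inj_on_eq_iff[OF bij_betw_imp_inj_on[OF b] that] by simp
  have "card {y \<in> Y. t g (t h y) \<noteq> t (g \<otimes>\<^bsub>G\<^esub> h) y}
      = card {x \<in> X. s g (s h x) \<noteq> s (g \<otimes>\<^bsub>G\<^esub> h) x}" if "g \<in> E" "h \<in> E" for g h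
    by (rule card_Collect_bij_betw[OF b]) (use that E in \<open>simp add: subset_iff bt t_mem eq_iff\<close>)
  moreover have "card {y \<in> Y. t g y \<noteq> y} = card {x \<in> X. s g x \<noteq> x}" if "g \<in> E" for g
    by (rule card_Collect_bij_betw[OF b]) (use that E in \<open>simp add: subset_iff bt t_mem eq_iff\<close>)
  ultimately have "sofic_approx G E \<epsilon> \<delta> Y t"
    using a tX Y by (simp add: sofic_approx_def)
  then show ?thesis unfolding Y_def by blast
qed

section \<open>Amplification of the separation by diagonal actions\<close>

lemma sofic_approx_mono:
  assumes "sofic_approx G E \<epsilon> \<delta> X s" "\<delta>' \<le> \<delta>"
  shows "sofic_approx G E \<epsilon> \<delta>' X s"
proof -
  have "\<delta>' * card X \<le> \<delta> * card X" using assms(2) by (simp add: mult_right_mono)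
  with assms(1) show ?thesis unfolding sofic_approx_def by (meson order.trans)
qed

text \<open>A pair is fixed by the diagonal action exactly when both entries are, so the proportion
  of fixed points is squared. A pair is a multiplicative defect only if one entry is, so the defect
  at most doubles.\<close>

lemma sofic_approx_square:
  fixes X :: "'x set"
  assumes G: "group G" and E: "E \<subseteq> carrier G" and a: "sofic_approx G E \<epsilon> (1 - r) X s"
    and "0 \<le> r"
  shows "sofic_approx G E (2 * \<epsilon>) (1 - r\<^sup>2) (X \<times> X)
    (\<lambda>g p. if p \<in> X \<times> X then map_prod (s g) (s g) p else p)" (is "sofic_approx _ _ _ _ _ ?t")
proof -
  interpret group G by fact
  have X: "finite X" "X \<noteq> {}" and s: "\<And>g. g \<in> carrier G \<Longrightarrow> s g permutes X"
    and mult: "\<And>g h. g \<in> E \<Longrightarrow> h \<in> E \<Longrightarrow>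
      real (card {x \<in> X. s g (s h x) \<noteq> s (g \<otimes>\<^bsub>G\<^esub> h) x}) \<le> \<epsilon> * card X"
    and move: "\<And>g. g \<in> E - {\<one>\<^bsub>G\<^esub>} \<Longrightarrow> (1 - r) * card X \<le> real (card {x \<in> X. s g x \<noteq> x})"
    using a by (auto simp: sofic_approx_def)
  have sX: "s g x \<in> X \<longleftrightarrow> x \<in> X" if "g \<in> carrier G" for g x
    using s that by (simp add: permutes_in_image)
  have "?t g permutes X \<times> X" if "g \<in> carrier G" for g
  proof (rule bij_imp_permutes)
    have b: "bij_betw (s g) X X" using s that permutes_imp_bij by blast
    show "bij_betw (?t g) (X \<times> X) (X \<times> X)"
      by (rule bij_betw_cong[THEN iffD1, OF _ bij_betw_map_prod[OF b b]]) simp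
  qed auto
  moreover have "real (card {p \<in> X \<times> X. ?t g (?t h p) \<noteq> ?t (g \<otimes>\<^bsub>G\<^esub> h) p})
      \<le> 2 * \<epsilon> * card (X \<times> X)" if g: "g \<in> E" "h \<in> E" for g h
  proof -
    let ?B = "{x \<in> X. s g (s h x) \<noteq> s (g \<otimes>\<^bsub>G\<^esub> h) x}"
    define D where "D = {p \<in> X \<times> X. ?t g (?t h p) \<noteq> ?t (g \<otimes>\<^bsub>G\<^esub> h) p}"
    have "D \<subseteq> ?B \<times> X \<union> X \<times> ?B"
      using g E sX by (auto simp: D_def split: if_splits)
    then have "card D \<le> card (?B \<times> X \<union> X \<times> ?B)"
      by (rule card_mono[rotated]) (use X in simp)
    also have "\<dots> \<le> card ?B * card X + card X * card ?B"
      by (rule order.trans[OF card_Un_le]) (simp add: card_cartesian_product)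
    finally have "real (card D) \<le> 2 * (real (card ?B) * card X)"
      by (simp add: mult.commute flip: of_nat_mult of_nat_add)
    also have "\<dots> \<le> 2 * (\<epsilon> * card X * card X)"
      using mult_right_mono[OF mult[OF g], of "real (card X)"] by simp
    finally show ?thesis by (simp add: card_cartesian_product D_def)
  qed
  moreover have "(1 - r\<^sup>2) * card (X \<times> X) \<le> real (card {p \<in> X \<times> X. ?t g p \<noteq> p})"
    if g: "g \<in> E - {\<one>\<^bsub>G\<^esub>}" for g
  proof -
    let ?F = "{x \<in> X. s g x = x}"
    have "card X = card ({x \<in> X. s g x \<noteq> x} \<union> ?F)" by (rule arg_cong[of _ _ card]) blast
    also have "\<dots> = card {x \<in> X. s g x \<noteq> x} + card ?F"
      by (rule card_Un_disjoint) (use X in auto)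
    finally have "real (card ?F) \<le> r * card X" using move[OF g] by (simp add: algebra_simps)
    then have F: "real (card ?F) * card ?F \<le> (r * card X) * (r * card X)"
      using \<open>0 \<le> r\<close> by (intro mult_mono) auto
    have "card (X \<times> X) = card ({p \<in> X \<times> X. ?t g p \<noteq> p} \<union> ?F \<times> ?F)"
      by (rule arg_cong[of _ _ card]) auto
    also have "\<dots> = card {p \<in> X \<times> X. ?t g p \<noteq> p} + card (?F \<times> ?F)"
      by (rule card_Un_disjoint) (use X in auto)
    finally have "real (card (X \<times> X)) = card {p \<in> X \<times> X. ?t g p \<noteq> p} + real (card ?F) * card ?F"
      by (simp add: card_cartesian_product)
    with F show ?thesis by (simp add: card_cartesian_product algebra_simps power2_eq_square)
  qed
  ultimately show ?thesis using X by (simp add: sofic_approx_def)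
qed

text \<open>Each squaring is followed by a return to an initial segment, which keeps the type of the
  permuted set fixed during the induction.\<close>

lemma sofic_approx_amplify:
  fixes X :: "'x set"
  assumes G: "group G" and E: "E \<subseteq> carrier G" and "0 \<le> r"
    and a: "sofic_approx G E \<epsilon> (1 - r) X s"
  shows "\<exists>n t. sofic_approx G E (2 ^ k * \<epsilon>) (1 - r ^ (2 ^ k)) {1..n::nat} t"
proof (induction k)
  case 0
  show ?case using sofic_approx_transfer[OF G E a] by auto
next
  case (Suc k)
  then obtain n :: nat and t where "sofic_approx G E (2 ^ k * \<epsilon>) (1 - r ^ (2 ^ k)) {1..n} t" by blast
  from sofic_approx_transfer[OF G E sofic_approx_square[OF G E this]] \<open>0 \<le> r\<close>
  show ?case by (fastforce simp: power_mult mult.assoc power2_eq_square simp flip: power_add mult_2)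
qed

text \<open>Pairs of a finite set and a precision index the ultraproduct, along an ultrafilter that
  makes the sets large and the precision fine. Since \<open>\<delta>\<close> depends on neither, the
  separation survives in the limit.\<close>

lemma soficI_approx:
  fixes G :: "('a, 'b) monoid_scheme"
  assumes G: "group G" and "0 < \<delta>"
    and approx: "\<And>E \<epsilon>. finite E \<Longrightarrow> E \<subseteq> carrier G \<Longrightarrow> 0 < \<epsilon> \<Longrightarrow>
      \<exists>(n::nat) s. sofic_approx G E \<epsilon> \<delta> {1..n} s"
  shows "sofic G"
proof -
  interpret group G by fact
  \<comment> \<open>\<open>fst b\<close> ranges over the finite subsets of the whole type, so it is
    cut down to the group.\<close>
  let ?E = "\<lambda>b. fst b \<inter> carrier G"
  have "\<forall>b :: 'a set \<times> nat. \<exists>n s. finite (fst b) \<longrightarrow> sofic_approx G (?E b) (1 / Suc (snd b)) \<delta> {1..n::nat} s"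
    using approx by simp
  then obtain n s where ns: "\<And>b :: 'a set \<times> nat. finite (fst b) \<Longrightarrow>
      sofic_approx G (?E b) (1 / Suc (snd b)) \<delta> {1..n b::nat} (s b)"
    by metis
  \<comment> \<open>Along \<open>F\<close>, every finite set is eventually contained in
    \<open>fst b\<close>, and \<open>snd b\<close> tends to infinity.\<close>
  define F :: "('a set \<times> nat) filter" where "F = finite_subsets_at_top UNIV \<times>\<^sub>F sequentially"
  define A :: "('a set \<times> nat) set" where "A = {b. finite (fst b)}"
  have "F \<noteq> bot" by (simp add: F_def prod_filter_eq_bot)
  then obtain U where UF: "U \<le> F" and U: "U \<noteq> bot"
    "\<forall>P. eventually P U \<or> eventually (\<lambda>x. \<not> P x) U"
    using ex_ultrafilter_le by blast
  have evE: "eventually (\<lambda>b. b \<in> A \<and> E \<subseteq> fst b) U" if "finite E" for E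
  proof (rule filter_leD[OF UF])
    have "eventually (\<lambda>X. finite X \<and> E \<subseteq> X) (finite_subsets_at_top UNIV)"
      using that by (auto simp: eventually_finite_subsets_at_top)
    then have "eventually (\<lambda>b. finite (fst b) \<and> E \<subseteq> fst b) F"
      unfolding F_def by (rule filter_leD[OF filtermap_fst_prod_filter, unfolded eventually_filtermap])
    then show "eventually (\<lambda>b. b \<in> A \<and> E \<subseteq> fst b) F" by (simp add: A_def)
  qed
  have lim: "((\<lambda>b. 1 / real (Suc (snd b))) \<longlongrightarrow> 0) U"
  proof (rule filterlim_compose[of "\<lambda>n. 1 / real (Suc n)" _ sequentially])
    show "((\<lambda>n. 1 / real (Suc n)) \<longlongrightarrow> 0) sequentially"
      using LIMSEQ_inverse_real_of_nat by (simp add: inverse_eq_divide)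
    have "filterlim snd sequentially F"
      unfolding F_def filterlim_def by (rule filtermap_snd_prod_filter)
    then show "filterlim snd sequentially U" by (rule filterlim_mono) (use UF in auto)
  qed
  have uA: "ultrafilter_on A U"
    using U evE[of "{}"] by (auto simp: ultrafilter_on_def elim: eventually_mono)
  define t where "t g = (\<lambda>b\<in>A. s b g)" for g
  have n: "n b > 0" if "b \<in> A" for b using ns[of b] that by (auto simp: sofic_approx_def A_def)
  have "sofic_via A U n G"
  proof (subst sofic_via_iff[OF G uA])
    show "\<forall>b\<in>A. n b > 0" using n by blast
    have "t \<in> carrier G \<rightarrow> carrier (sym_product A n)"
      using ns by (auto simp: sym_product_carrier t_def sofic_approx_def A_def)
    moreover have "((\<lambda>b. hamm_dist (n b) (t g b \<circ> t h b) (t (g \<otimes>\<^bsub>G\<^esub> h) b)) \<longlongrightarrow> 0) U"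
      if "g \<in> carrier G" "h \<in> carrier G" for g h
    proof (rule tendsto_sandwich[OF _ _ tendsto_const lim])
      show "eventually (\<lambda>b. hamm_dist (n b) (t g b \<circ> t h b) (t (g \<otimes>\<^bsub>G\<^esub> h) b) \<le> 1 / Suc (snd b)) U"
        using evE[of "{g, h}", simplified]
      proof eventually_elim
        case (elim b)
        then have "real (card {x \<in> {1..n b}. s b g (s b h x) \<noteq> s b (g \<otimes>\<^bsub>G\<^esub> h) x})
            \<le> 1 / Suc (snd b) * card {1..n b}"
          using ns[of b] that by (simp add: sofic_approx_def A_def)
        then show ?case using elim n by (simp add: hamm_dist_def t_def field_simps)
      qed
    qed (simp add: hamm_dist_nonneg)
    moreover have "\<not> ((\<lambda>b. hamm_dist (n b) (t g b) id) \<longlongrightarrow> 0) U"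
      if g: "g \<in> carrier G - {\<one>\<^bsub>G\<^esub>}" for g
    proof
      assume "((\<lambda>b. hamm_dist (n b) (t g b) id) \<longlongrightarrow> 0) U"
      from order_tendstoD(2)[OF this \<open>0 < \<delta>\<close>]
      have "eventually (\<lambda>b. hamm_dist (n b) (t g b) id < \<delta>) U" .
      with evE[of "{g}", simplified] have "eventually (\<lambda>b. False) U"
      proof eventually_elim
        case (elim b)
        then have "\<delta> * card {1..n b} \<le> real (card {x \<in> {1..n b}. s b g x \<noteq> x})"
          using ns[of b] g by (simp add: sofic_approx_def A_def)
        then show ?case using elim n[of b] by (simp add: hamm_dist_def t_def field_simps)
      qed
      then show False using U(1) by (simp add: trivial_limit_def)
    qed
    ultimately show "\<exists>t\<in>carrier G \<rightarrow> carrier (sym_product A n).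
      (\<forall>g\<in>carrier G. \<forall>h\<in>carrier G.
        ((\<lambda>b. hamm_dist (n b) (t g b \<circ> t h b) (t (g \<otimes>\<^bsub>G\<^esub> h) b)) \<longlongrightarrow> 0) U) \<and>
      (\<forall>g\<in>carrier G - {\<one>\<^bsub>G\<^esub>}. \<not> ((\<lambda>b. hamm_dist (n b) (t g b) id) \<longlongrightarrow> 0) U)"
      by blast
  qed
  then show ?thesis unfolding sofic_def by blast
qed

text \<open>In an ultraproduct embedding each nontrivial element of \<open>E\<close> stays a
  definite distance from the identity on a large index set. The bound \<open>r\<close> may depend on
  \<open>E\<close>, but it is chosen before \<open>\<epsilon>\<close>, which amplification
  requires.\<close>

lemma sofic_imp_approx_weak:
  fixes G :: "('a, 'b) monoid_scheme"
  assumes G: "group G" and sof: "sofic G" and E: "finite E" "E \<subseteq> carrier G"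
  shows "\<exists>r\<ge>0. r < 1 \<and> (\<forall>\<epsilon>>0. \<exists>(n::nat) s. sofic_approx G E \<epsilon> (1 - r) {1..n} s)"
proof -
  interpret group G by fact
  obtain A :: "('a set \<times> nat) set" and U n where via: "sofic_via A U n G"
    using sof unfolding sofic_def by blast
  have U: "ultrafilter_on A U" and n: "\<forall>\<alpha>\<in>A. n \<alpha> > 0"
    using via by (auto simp: sofic_via_def)
  have A: "eventually (\<lambda>\<alpha>. \<alpha> \<in> A) U" and bot: "U \<noteq> bot"
    and ultra: "\<And>P. eventually P U \<or> eventually (\<lambda>\<alpha>. \<not> P \<alpha>) U"
    using U by (auto simp: ultrafilter_on_def)
  obtain s where s: "\<And>g. g \<in> carrier G \<Longrightarrow> s g \<in> carrier (sym_product A n)"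
    and mult: "\<And>g h. g \<in> carrier G \<Longrightarrow> h \<in> carrier G \<Longrightarrow>
        ((\<lambda>\<alpha>. hamm_dist (n \<alpha>) (s g \<alpha> \<circ> s h \<alpha>) (s (g \<otimes>\<^bsub>G\<^esub> h) \<alpha>)) \<longlongrightarrow> 0) U"
    and sep: "\<And>g. g \<in> carrier G - {\<one>\<^bsub>G\<^esub>} \<Longrightarrow>
        \<not> ((\<lambda>\<alpha>. hamm_dist (n \<alpha>) (s g \<alpha>) id) \<longlongrightarrow> 0) U"
    using via sofic_via_iff[OF G U n] by blast
  have "\<exists>r<1. eventually (\<lambda>\<alpha>. 1 - r \<le> hamm_dist (n \<alpha>) (s g \<alpha>) id) U"
    if g: "g \<in> carrier G - {\<one>\<^bsub>G\<^esub>}" for g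
  proof -
    obtain e where "e > 0"
      and "\<not> eventually (\<lambda>\<alpha>. dist (hamm_dist (n \<alpha>) (s g \<alpha>) id) 0 < e) U"
      using sep[OF g] unfolding tendsto_iff by blast
    with ultra[of "\<lambda>\<alpha>. dist (hamm_dist (n \<alpha>) (s g \<alpha>) id) 0 < e"]
    have "eventually (\<lambda>\<alpha>. 1 - (1 - e) \<le> hamm_dist (n \<alpha>) (s g \<alpha>) id) U"
      by (simp add: not_less hamm_dist_nonneg)
    with \<open>e > 0\<close> show ?thesis by (intro exI[of _ "1 - e"]) auto
  qed
  then obtain r where r: "\<And>g. g \<in> carrier G - {\<one>\<^bsub>G\<^esub>} \<Longrightarrow> r g < 1"
    and sep': "\<And>g. g \<in> carrier G - {\<one>\<^bsub>G\<^esub>} \<Longrightarrow>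
      eventually (\<lambda>\<alpha>. 1 - r g \<le> hamm_dist (n \<alpha>) (s g \<alpha>) id) U"
    by metis
  \<comment> \<open>Inserting 0 keeps the set nonempty and makes \<open>R\<close> nonnegative, as
    needed for squaring.\<close>
  define R :: real where "R = Max (insert 0 (r ` (E - {\<one>\<^bsub>G\<^esub>})))"
  have R: "0 \<le> R" "R < 1" "\<And>g. g \<in> E - {\<one>\<^bsub>G\<^esub>} \<Longrightarrow> r g \<le> R"
    using E r by (auto simp: R_def)
  have "\<exists>(n::nat) s. sofic_approx G E \<epsilon> (1 - R) {1..n} s" if "\<epsilon> > 0" for \<epsilon>
  proof -
    have "eventually (\<lambda>\<alpha>. \<forall>g\<in>E. \<forall>h\<in>E.
        hamm_dist (n \<alpha>) (s g \<alpha> \<circ> s h \<alpha>) (s (g \<otimes>\<^bsub>G\<^esub> h) \<alpha>) < \<epsilon>) U"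
      using E that by (intro eventually_ball_finite ballI order_tendstoD(2)[OF mult]) auto
    moreover have "eventually (\<lambda>\<alpha>. \<forall>g\<in>E - {\<one>\<^bsub>G\<^esub>}. 1 - r g \<le> hamm_dist (n \<alpha>) (s g \<alpha>) id) U"
      using E sep' by (intro eventually_ball_finite) auto
    ultimately have "eventually (\<lambda>\<alpha>. \<alpha> \<in> A \<and> (\<forall>g\<in>E. \<forall>h\<in>E.
        hamm_dist (n \<alpha>) (s g \<alpha> \<circ> s h \<alpha>) (s (g \<otimes>\<^bsub>G\<^esub> h) \<alpha>) < \<epsilon>) \<and>
      (\<forall>g\<in>E - {\<one>\<^bsub>G\<^esub>}. 1 - r g \<le> hamm_dist (n \<alpha>) (s g \<alpha>) id)) U"
      using A by eventually_elim blast
    then obtain \<alpha> where \<alpha>: "\<alpha> \<in> A"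
      and m: "\<And>g h. g \<in> E \<Longrightarrow> h \<in> E \<Longrightarrow>
        hamm_dist (n \<alpha>) (s g \<alpha> \<circ> s h \<alpha>) (s (g \<otimes>\<^bsub>G\<^esub> h) \<alpha>) < \<epsilon>"
      and d: "\<And>g. g \<in> E - {\<one>\<^bsub>G\<^esub>} \<Longrightarrow> 1 - r g \<le> hamm_dist (n \<alpha>) (s g \<alpha>) id"
      using eventually_happens[of _ U] bot by (auto dest!: eventually_happens)
    have "1 - R \<le> hamm_dist (n \<alpha>) (s g \<alpha>) id" if "g \<in> E - {\<one>\<^bsub>G\<^esub>}" for g
      using d[OF that] R(3)[OF that] by simp
    moreover have "n \<alpha> > 0" using n \<alpha> by blast
    ultimately have "sofic_approx G E \<epsilon> (1 - R) {1..n \<alpha>} (\<lambda>g. s g \<alpha>)"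
      using s \<alpha> m[THEN less_imp_le]
      by (auto simp: sofic_approx_def sym_product_carrier hamm_dist_def field_simps)
    then show ?thesis by blast
  qed
  with R show ?thesis by blast
qed

text \<open>The separation in the definition of an embedding may depend on the group element.  Passing
  to the diagonal action on a large power of the permuted set makes it uniform, at the cost of a
  proportionally larger defect.\<close>

lemma sofic_imp_approx:
  assumes G: "group G" and "sofic G" and E: "finite E" "E \<subseteq> carrier G" and "0 < \<epsilon>"
  shows "\<exists>(n::nat) s. sofic_approx G E \<epsilon> (1/2) {1..n} s"
proof -
  obtain r where r: "0 \<le> r" "r < 1"
    and a: "\<And>\<epsilon>. \<epsilon> > 0 \<Longrightarrow> \<exists>(n::nat) s. sofic_approx G E \<epsilon> (1 - r) {1..n} s"
    using sofic_imp_approx_weak[OF assms(1-4)] by blast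
  \<comment> \<open>\<open>2 ^ k\<close> is at least \<open>k\<close>, so \<open>k\<close> squarings
    push the proportion of fixed points below 1/2.\<close>
  obtain k where k: "r ^ k < 1/2" using real_arch_pow_inv[of "1/2" r] r by auto
  have "r ^ (2 ^ k) \<le> r ^ k" using r by (intro power_decreasing) auto
  with k have "1/2 \<le> 1 - r ^ (2 ^ k)" by simp
  \<comment> \<open>The factor \<open>2 ^ k\<close> that \<open>k\<close> squarings cost is divided
    out in advance.\<close>
  moreover obtain n :: nat and s where "sofic_approx G E (\<epsilon> / 2 ^ k) (1 - r) {1..n} s"
    using a[of "\<epsilon> / 2 ^ k"] \<open>0 < \<epsilon>\<close> by auto
  from sofic_approx_amplify[OF G E(2) r(1) this, of k]
  have "\<exists>n t. sofic_approx G E \<epsilon> (1 - r ^ (2 ^ k)) {1..n::nat} t" by simp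
  ultimately show ?thesis using sofic_approx_mono by blast
qed

section \<open>Induced approximations\<close>

text \<open>This is co-amenability of \<open>H\<close> in \<open>G\<close>: the Folner condition for
  left translation on the cosets of \<open>H\<close>.\<close>

definition coset_folner :: "('a, 'b) monoid_scheme \<Rightarrow> 'a set \<Rightarrow> bool" where
  "coset_folner G H \<longleftrightarrow> (\<forall>E (\<epsilon>::real). finite E \<and> E \<subseteq> carrier G \<and> 0 < \<epsilon> \<longrightarrow>
     (\<exists>F. finite F \<and> F \<noteq> {} \<and> F \<subseteq> lcosets\<^bsub>G\<^esub> H \<and>
       (\<forall>g\<in>E. real (card {q \<in> F. g <#\<^bsub>G\<^esub> q \<notin> F}) \<le> \<epsilon> * card F)))"

text \<open>The complements of \<open>D\<close> and of its image are equally large finite sets, and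
  any bijection between them completes \<open>p\<close>.\<close>

lemma inj_on_extends_to_permutation:
  assumes "finite X" "D \<subseteq> X" "p ` D \<subseteq> X" "inj_on p D"
  shows "\<exists>\<pi>. \<pi> permutes X \<and> (\<forall>x\<in>D. \<pi> x = p x)"
proof -
  have "card (X - D) = card (X - p ` D)"
    using assms by (simp add: card_Diff_subset finite_subset card_image)
  then obtain f where f: "bij_betw f (X - D) (X - p ` D)"
    using finite_same_card_bij[OF finite_Diff finite_Diff, OF assms(1) assms(1)] by auto
  have eq: "p ` D \<union> (X - p ` D) = X" "D \<union> (X - D) = X" using assms by auto
  define \<pi> where "\<pi> x = (if x \<in> D then p x else if x \<in> X - D then f x else x)" for x
  have "bij_betw \<pi> D (p ` D)"
    using assms(4) by (auto simp: bij_betw_def \<pi>_def inj_on_def)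
  moreover have "bij_betw \<pi> (X - D) (X - p ` D)"
    by (rule bij_betw_cong[THEN iffD1, OF _ f]) (auto simp: \<pi>_def)
  ultimately have "bij_betw \<pi> (D \<union> (X - D)) (p ` D \<union> (X - p ` D))"
    by (rule bij_betw_combine) blast
  then have "\<pi> permutes X"
    unfolding eq by (rule bij_imp_permutes) (use assms(2) in \<open>auto simp: \<pi>_def\<close>)
  then show ?thesis by (intro exI[of _ \<pi>]) (simp add: \<pi>_def)
qed

text \<open>Induced permutations: the partial action of \<open>G\<close> on a Folner set \<open>F\<close> of cosets is combined with
  an approximation of \<open>H\<close> on \<open>X\<close> to partial permutations of \<open>F \<times> X\<close>, along the cocycle
  \<open>c g q = t(gq)\<inverse> g t(q)\<close> given by a choice \<open>t\<close> of coset representatives.\<close>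

theorem sofic_of_coset_folner:
  assumes G: "group G" and H: "subgroup H G" and sof: "sofic (G\<lparr>carrier := H\<rparr>)"
    and fol: "coset_folner G H"
  shows "sofic G"
proof (rule soficI_approx[OF G, of "1/4"])
  interpret group G by fact
  interpret H: subgroup H G by fact
  let ?Q = "lcosets\<^bsub>G\<^esub> H"
  have GH: "group (G\<lparr>carrier := H\<rparr>)" by (rule subgroup_imp_group[OF H])
  define t where "t q = (SOME x. x \<in> q)" for q :: "'a set"
  have tq: "t q \<in> carrier G \<and> q = t q <#\<^bsub>G\<^esub> H" if "q \<in> ?Q" for q
  proof -
    obtain a where a: "a \<in> carrier G" "q = a <#\<^bsub>G\<^esub> H" using \<open>q \<in> ?Q\<close> by (auto simp: LCOSETS_def)
    then have "a \<in> q" using lcos_self[OF _ H] by blast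
    then have "t q \<in> a <#\<^bsub>G\<^esub> H" unfolding t_def a(2)[symmetric] by (rule someI)
    then show ?thesis using a l_coset_carrier[OF _ a(1) H] l_repr_independence[OF _ a(1) H]
      by blast
  qed
  have act: "g <#\<^bsub>G\<^esub> q \<in> ?Q" "g <#\<^bsub>G\<^esub> (h <#\<^bsub>G\<^esub> q) = (g \<otimes>\<^bsub>G\<^esub> h) <#\<^bsub>G\<^esub> q"
    if "g \<in> carrier G" "h \<in> carrier G" "q \<in> ?Q" for g h q
    using that H.subset l_coset_subset_G[OF H.subset]
    by (auto simp: LCOSETS_def lcos_m_assoc intro!: bexI[of _ "g \<otimes>\<^bsub>G\<^esub> _"])
  have act_inj: "q = q'" if "g <#\<^bsub>G\<^esub> q = g <#\<^bsub>G\<^esub> q'" "g \<in> carrier G" "q \<in> ?Q" "q' \<in> ?Q" for g q q'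
  proof -
    have "inv\<^bsub>G\<^esub> g <#\<^bsub>G\<^esub> (g <#\<^bsub>G\<^esub> p) = p" if "p \<in> ?Q" for p
      using that \<open>g \<in> carrier G\<close> act(2)[of "inv\<^bsub>G\<^esub> g" g p]
      by (simp add: lcos_mult_one H.lcosets_carrier[OF G])
    then show ?thesis using that by metis
  qed
  define c where "c g q = inv\<^bsub>G\<^esub> t (g <#\<^bsub>G\<^esub> q) \<otimes>\<^bsub>G\<^esub> (g \<otimes>\<^bsub>G\<^esub> t q)" for g q
  have cH: "c g q \<in> H" if "g \<in> carrier G" "q \<in> ?Q" for g q
  proof -
    have "g \<otimes>\<^bsub>G\<^esub> t q \<in> g <#\<^bsub>G\<^esub> q"
      using tq[OF that(2)] lcos_self[OF _ H, of "t q"] that(1) by (auto simp: l_coset_def)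
    moreover have "g <#\<^bsub>G\<^esub> q = t (g <#\<^bsub>G\<^esub> q) <#\<^bsub>G\<^esub> H" "t (g <#\<^bsub>G\<^esub> q) \<in> carrier G"
      using tq act that by blast+
    ultimately show ?thesis unfolding c_def using H.lcos_module_imp[OF G] by metis
  qed
  have c_mult: "c g (h <#\<^bsub>G\<^esub> q) \<otimes>\<^bsub>G\<^esub> c h q = c (g \<otimes>\<^bsub>G\<^esub> h) q"
    if "g \<in> carrier G" "h \<in> carrier G" "q \<in> ?Q" for g h q
  proof -
    have "t q \<in> carrier G" "t (h <#\<^bsub>G\<^esub> q) \<in> carrier G" "t ((g \<otimes>\<^bsub>G\<^esub> h) <#\<^bsub>G\<^esub> q) \<in> carrier G"
      using tq act that by auto
    then show ?thesis using that
      by (simp add: c_def act m_assoc inv_solve_left' flip: m_assoc[of "t (h <#\<^bsub>G\<^esub> q)" "inv\<^bsub>G\<^esub> t (h <#\<^bsub>G\<^esub> q)"])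
  qed
  \<comment> \<open>If \<open>g\<close> fixes the coset \<open>q\<close>, then \<open>c g q\<close>
    is a conjugate of \<open>g\<close> by \<open>t q\<close>, hence trivial only for trivial
    \<open>g\<close>.\<close>
  have c_one: "g = \<one>\<^bsub>G\<^esub>" if "g \<in> carrier G" "q \<in> ?Q" "g <#\<^bsub>G\<^esub> q = q" "c g q = \<one>\<^bsub>G\<^esub>" for g q
  proof -
    have "t q \<in> carrier G" using tq that(2) by blast
    moreover from this have "g \<otimes>\<^bsub>G\<^esub> t q = t q"
      using that by (simp add: c_def inv_solve_left')
    ultimately show ?thesis using that(1) by (simp add: r_cancel_one')
  qed
  fix E :: "'a set" and \<epsilon> :: real
  assume E: "finite E" "E \<subseteq> carrier G" and "0 < \<epsilon>"
  \<comment> \<open>A third of \<open>\<epsilon>\<close> goes to each of three exceptional sets; the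
    cap 1/2 leaves at least half of \<open>F\<close> inside \<open>D g\<close> for the
    separation.\<close>
  define \<eta> where "\<eta> = min (\<epsilon> / 3) (1/2)"
  have \<eta>: "0 < \<eta>" "3 * \<eta> \<le> \<epsilon>" "\<eta> \<le> 1/2" using \<open>0 < \<epsilon>\<close> by (auto simp: \<eta>_def)
  \<comment> \<open>Products are included because multiplicativity also needs \<open>F\<close> to be
    almost invariant under the product of \<open>g\<close> and \<open>h\<close>.\<close>
  let ?E = "E \<union> (\<lambda>(g, h). g \<otimes>\<^bsub>G\<^esub> h) ` (E \<times> E)"
  have E': "finite ?E" "?E \<subseteq> carrier G" using E by auto
  have "\<exists>F. finite F \<and> F \<noteq> {} \<and> F \<subseteq> ?Q \<and>
      (\<forall>g\<in>?E. real (card {q \<in> F. g <#\<^bsub>G\<^esub> q \<notin> F}) \<le> \<eta> * card F)"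
    by (rule fol[unfolded coset_folner_def, rule_format]) (intro conjI E' \<eta>(1))
  then obtain F where F: "finite F" "F \<noteq> {}" "F \<subseteq> ?Q"
    and folF: "\<And>g. g \<in> ?E \<Longrightarrow> real (card {q \<in> F. g <#\<^bsub>G\<^esub> q \<notin> F}) \<le> \<eta> * card F"
    by (elim exE conjE) (rule that, assumption+, rule bspec)
  \<comment> \<open>The cocycle values of \<open>E\<close> over \<open>F\<close>: the finite set on
    which the approximation of \<open>H\<close> has to be good.\<close>
  let ?C = "(\<lambda>(g, q). c g q) ` (E \<times> F)"
  have C: "finite ?C" "?C \<subseteq> carrier (G\<lparr>carrier := H\<rparr>)"
    using E F cH by (auto simp: subset_iff)
  obtain n :: nat and s where ap: "sofic_approx (G\<lparr>carrier := H\<rparr>) ?C \<eta> (1/2) {1..n} s"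
    using sofic_imp_approx[OF GH sof C \<eta>(1)] by blast
  define X where "X = {1..n}"
  note ap = ap[folded X_def]
  have X: "finite X" "X \<noteq> {}" and s: "\<And>g. g \<in> H \<Longrightarrow> s g permutes X"
    using ap by (auto simp: sofic_approx_def)
  have mult: "real (card {x \<in> X. s (c g q) (s (c h p) x) \<noteq> s (c g q \<otimes>\<^bsub>G\<^esub> c h p) x}) \<le> \<eta> * card X"
    if "g \<in> E" "h \<in> E" "q \<in> F" "p \<in> F" for g h q p
  proof -
    have m: "c g q \<in> ?C" "c h p \<in> ?C" using that by auto
    have "real (card {x \<in> X. s (c g q) (s (c h p) x)
        \<noteq> s (c g q \<otimes>\<^bsub>G\<lparr>carrier := H\<rparr>\<^esub> c h p) x}) \<le> \<eta> * card X"
      using ap unfolding sofic_approx_def by (elim conjE) (drule bspec[OF _ m(1)], rule bspec[OF _ m(2)])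
    then show ?thesis by simp
  qed
  have move: "1/2 * card X \<le> real (card {x \<in> X. s (c g q) x \<noteq> x})"
    if "g \<in> E" "q \<in> F" "c g q \<noteq> \<one>\<^bsub>G\<^esub>" for g q
  proof -
    have "c g q \<in> ?C - {\<one>\<^bsub>G\<lparr>carrier := H\<rparr>\<^esub>}" using that by auto
    with ap show ?thesis unfolding sofic_approx_def by (elim conjE) (rule bspec)
  qed
  define p where "p g = (\<lambda>(q, x). (g <#\<^bsub>G\<^esub> q, s (c g q) x))" for g
  \<comment> \<open>Over \<open>D g\<close> the partial action stays inside \<open>F\<close> and
    \<open>p g\<close> is injective; elsewhere any completion to a permutation will do.\<close>
  define D where "D g = {q \<in> F. g <#\<^bsub>G\<^esub> q \<in> F}" for g
  have "\<exists>\<pi>. \<pi> permutes F \<times> X \<and> (\<forall>x\<in>D g \<times> X. \<pi> x = p g x)" if "g \<in> carrier G" for g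
  proof (rule inj_on_extends_to_permutation)
    have sc: "s (c g q) permutes X" if "q \<in> F" for q
      using s cH \<open>g \<in> carrier G\<close> F that by blast
    show "p g ` (D g \<times> X) \<subseteq> F \<times> X"
      using permutes_in_image[OF sc] by (auto simp: p_def D_def)
    show "inj_on (p g) (D g \<times> X)"
    proof (rule inj_onI, clarify)
      fix q x q' x' assume q: "q \<in> D g" "q' \<in> D g" and eq: "p g (q, x) = p g (q', x')"
      then have "q = q'" using act_inj[of g q q'] F \<open>g \<in> carrier G\<close> by (auto simp: p_def D_def)
      with eq q show "q = q' \<and> x = x'"
        using permutes_inj[OF sc[of q]] by (auto simp: p_def D_def inj_eq)
    qed
  qed (use F X in \<open>auto simp: D_def\<close>)
  then obtain \<pi> where \<pi>: "\<And>g. g \<in> carrier G \<Longrightarrow> \<pi> g permutes F \<times> X"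
    and \<pi>p: "\<And>g q x. g \<in> carrier G \<Longrightarrow> q \<in> D g \<Longrightarrow> x \<in> X \<Longrightarrow>
      \<pi> g (q, x) = (g <#\<^bsub>G\<^esub> q, s (c g q) x)"
    by (auto simp: p_def) metis
  have bad: "real (card ({q \<in> F. g <#\<^bsub>G\<^esub> q \<notin> F} \<times> X)) \<le> \<eta> * card (F \<times> X)" if "g \<in> ?E" for g
    using mult_right_mono[OF folF[OF that], of "real (card X)"] by (simp add: card_cartesian_product)
  have "real (card {y \<in> F \<times> X. \<pi> g (\<pi> h y) \<noteq> \<pi> (g \<otimes>\<^bsub>G\<^esub> h) y}) \<le> \<epsilon> * card (F \<times> X)"
    if g: "g \<in> E" "h \<in> E" for g h
  proof -
    have gh: "g \<in> carrier G" "h \<in> carrier G" using g E by auto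
    define B where "B q = {x \<in> X. s (c g (h <#\<^bsub>G\<^esub> q)) (s (c h q) x) \<noteq>
      s (c g (h <#\<^bsub>G\<^esub> q) \<otimes>\<^bsub>G\<^esub> c h q) x}" for q
    \<comment> \<open>Multiplicativity can fail only where \<open>h\<close> or the product leaves
      \<open>F\<close>, or where the approximation of \<open>H\<close> on the fibre over
      \<open>q\<close> is not multiplicative.\<close>
    let ?B1 = "{q \<in> F. h <#\<^bsub>G\<^esub> q \<notin> F} \<times> X"
    let ?B2 = "{q \<in> F. (g \<otimes>\<^bsub>G\<^esub> h) <#\<^bsub>G\<^esub> q \<notin> F} \<times> X"
    let ?B3 = "Sigma (D h) B"
    have "{y \<in> F \<times> X. \<pi> g (\<pi> h y) \<noteq> \<pi> (g \<otimes>\<^bsub>G\<^esub> h) y} \<subseteq> ?B1 \<union> ?B2 \<union> ?B3"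
    proof (rule subsetI, rule ccontr)
      fix y assume y: "y \<in> {y \<in> F \<times> X. \<pi> g (\<pi> h y) \<noteq> \<pi> (g \<otimes>\<^bsub>G\<^esub> h) y}"
        and nB: "y \<notin> ?B1 \<union> ?B2 \<union> ?B3"
      obtain q x where qx: "y = (q, x)" by (cases y)
      have q: "q \<in> F" "x \<in> X" and ne: "\<pi> g (\<pi> h (q, x)) \<noteq> \<pi> (g \<otimes>\<^bsub>G\<^esub> h) (q, x)"
        using y qx by auto
      have h: "q \<in> D h" and nB3: "x \<notin> B q" and ghF: "(g \<otimes>\<^bsub>G\<^esub> h) <#\<^bsub>G\<^esub> q \<in> F"
        using nB qx q by (auto simp: D_def)
      have qQ: "q \<in> ?Q" using q F by blast
      have D: "q \<in> D (g \<otimes>\<^bsub>G\<^esub> h)" "h <#\<^bsub>G\<^esub> q \<in> D g"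
        using ghF h q act(2)[OF gh qQ] by (simp_all add: D_def)
      have "s (c h q) x \<in> X"
        using permutes_in_image[OF s[OF cH[OF gh(2) qQ]]] q by blast
      with D show False
        using ne nB3 h q gh qQ by (simp add: \<pi>p B_def act c_mult)
    qed
    then have "card {y \<in> F \<times> X. \<pi> g (\<pi> h y) \<noteq> \<pi> (g \<otimes>\<^bsub>G\<^esub> h) y} \<le> card (?B1 \<union> ?B2 \<union> ?B3)"
      by (rule card_mono[rotated]) (use F X in \<open>auto simp: D_def B_def\<close>)
    also have "\<dots> \<le> card ?B1 + card ?B2 + card ?B3"
      by (meson card_Un_le order.trans add_le_mono1)
    finally have "real (card {y \<in> F \<times> X. \<pi> g (\<pi> h y) \<noteq> \<pi> (g \<otimes>\<^bsub>G\<^esub> h) y})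
        \<le> real (card ?B1) + real (card ?B2) + real (card ?B3)" by linarith
    moreover have "real (card ?B3) \<le> \<eta> * card (F \<times> X)"
    proof -
      have "real (card ?B3) = (\<Sum>q\<in>D h. real (card (B q)))"
        using F X by (subst card_SigmaI) (auto simp: D_def B_def)
      also have "\<dots> \<le> (\<Sum>q\<in>D h. \<eta> * card X)"
        by (rule sum_mono) (use mult[OF g] in \<open>simp add: B_def D_def\<close>)
      also have "\<dots> = card (D h) * (\<eta> * card X)" by simp
      also have "\<dots> \<le> card F * (\<eta> * card X)"
        using F \<eta> by (intro mult_right_mono) (auto simp: D_def card_mono)
      finally show ?thesis by (simp add: card_cartesian_product mult_ac)
    qed
    moreover have "3 * \<eta> * card (F \<times> X) \<le> \<epsilon> * card (F \<times> X)"
      by (rule mult_right_mono[OF \<eta>(2)]) simp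
    ultimately show ?thesis using bad[of h] bad[of "g \<otimes>\<^bsub>G\<^esub> h"] g by fastforce
  qed
  moreover have "1/4 * card (F \<times> X) \<le> real (card {y \<in> F \<times> X. \<pi> g y \<noteq> y})"
    if g: "g \<in> E - {\<one>\<^bsub>G\<^esub>}" for g
  proof -
    have gG: "g \<in> carrier G" using g E by auto
    define B where "B q = {x \<in> X. \<pi> g (q, x) \<noteq> (q, x)}" for q
    \<comment> \<open>A moved coset moves its whole fibre. Over a fixed coset the cocycle value is
      nontrivial, so at least half of the fibre moves. With at least half of \<open>F\<close> in
      \<open>D g\<close> this gives the quarter.\<close>
    have B: "1/2 * card X \<le> real (card (B q))" if "q \<in> D g" for q
    proof (cases "g <#\<^bsub>G\<^esub> q = q")
      case True
      have q: "q \<in> F" "q \<in> ?Q" using that F by (auto simp: D_def)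
      have "B q = {x \<in> X. s (c g q) x \<noteq> x}" using True that gG by (auto simp: B_def \<pi>p)
      moreover have "c g q \<noteq> \<one>\<^bsub>G\<^esub>" using c_one[OF gG q(2) True] g by blast
      ultimately show ?thesis using move[of g q] g q by simp
    next
      case False
      then have "B q = X" using that gG by (auto simp: B_def \<pi>p)
      then show ?thesis by simp
    qed
    have "F = D g \<union> {q \<in> F. g <#\<^bsub>G\<^esub> q \<notin> F}" by (auto simp: D_def)
    then have "card F \<le> card (D g) + card {q \<in> F. g <#\<^bsub>G\<^esub> q \<notin> F}"
      by (metis card_Un_le)
    then have "real (card F) \<le> card (D g) + \<eta> * card F" using folF[of g] g by fastforce
    moreover have "\<eta> * card F \<le> 1/2 * card F" using \<eta> by (intro mult_right_mono) auto
    ultimately have "1/2 * card F \<le> real (card (D g))" by simp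
    then have "1/2 * card F * (1/2 * card X) \<le> card (D g) * (1/2 * card X)"
      by (intro mult_right_mono) auto
    also have "\<dots> = (\<Sum>q\<in>D g. 1/2 * card X)" by simp
    also have "\<dots> \<le> (\<Sum>q\<in>D g. real (card (B q)))" by (rule sum_mono) (rule B)
    also have "\<dots> = real (card (Sigma (D g) B))"
      using F X by (subst card_SigmaI) (auto simp: D_def B_def)
    also have "\<dots> \<le> real (card {y \<in> F \<times> X. \<pi> g y \<noteq> y})"
      using F X by (intro of_nat_mono card_mono) (auto simp: D_def B_def)
    finally show ?thesis by (simp add: card_cartesian_product)
  qed
  ultimately have "sofic_approx G E \<epsilon> (1/4) (F \<times> X) \<pi>"
    using F X \<pi> by (simp add: sofic_approx_def)
  from sofic_approx_transfer[OF G E(2) this]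
  show "\<exists>(n::nat) s. sofic_approx G E \<epsilon> (1/4) {1..n} s" by blast
qed simp

text \<open>With finitely many cosets, the set of all cosets is invariant and serves as Folner set
  for every \<open>\<epsilon>\<close>.\<close>

theorem sofic_of_finite_index:
  assumes "group G" "subgroup H G" "sofic (G\<lparr>carrier := H\<rparr>)" and fin: "finite (lcosets\<^bsub>G\<^esub> H)"
  shows "sofic G"
proof (rule sofic_of_coset_folner[OF assms(1-3)])
  interpret group G by fact
  interpret H: subgroup H G by fact
  have "H \<in> lcosets\<^bsub>G\<^esub> H"
    using lcos_mult_one[OF H.subset] by (auto simp: LCOSETS_def intro!: bexI[of _ "\<one>\<^bsub>G\<^esub>"])
  moreover have "g <#\<^bsub>G\<^esub> q \<in> lcosets\<^bsub>G\<^esub> H" if "g \<in> carrier G" "q \<in> lcosets\<^bsub>G\<^esub> H" for g q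
    using that H.subset by (auto simp: LCOSETS_def lcos_m_assoc intro!: bexI[of _ "g \<otimes>\<^bsub>G\<^esub> _"])
  then have empty: "{q \<in> lcosets\<^bsub>G\<^esub> H. g <#\<^bsub>G\<^esub> q \<notin> lcosets\<^bsub>G\<^esub> H} = {}" if "g \<in> carrier G" for g
    using that by blast
  ultimately show "coset_folner G H"
    unfolding coset_folner_def using fin
    by (intro allI impI exI[of _ "lcosets\<^bsub>G\<^esub> H"]) (auto simp: empty subsetD)
qed

lemma (in group) normal_lcosets:
  assumes "N \<lhd> G"
  shows "lcosets N = carrier (G Mod N)"
proof -
  have "a <# N = N #> a" if "a \<in> carrier G" for a
    using normal.coset_eq[OF assms] that by blast
  then show ?thesis unfolding LCOSETS_def FactGroup_def RCOSETS_def by simp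
qed

section \<open>Folner sets of amenable groups\<close>

text \<open>Rado's argument: in a family that is minimal subject to Hall's condition all sets are
  singletons, because if neither \<open>x\<close> nor \<open>y\<close> can be removed from \<open>B i\<close>, then two tight subfamilies
  contradict submodularity of the size of the union.\<close>

theorem marriage_Rado:
  fixes A :: "'i \<Rightarrow> 'b set"
  assumes fin: "\<And>i. i \<in> I \<Longrightarrow> finite (A i)"
    and hall: "\<And>J. finite J \<Longrightarrow> J \<subseteq> I \<Longrightarrow> card J \<le> card (\<Union>i\<in>J. A i)"
  shows "\<exists>f. inj_on f I \<and> (\<forall>i\<in>I. f i \<in> A i)"
proof -
  \<comment> \<open>\<open>D\<close> is a set of deleted pairs and \<open>B D i\<close> what it
    leaves of \<open>A i\<close>; a maximal \<open>D\<close> in \<open>\<D>\<close> gives a minimal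
    family that satisfies Hall's condition.\<close>
  define B where "B D i = {y \<in> A i. (i, y) \<notin> D}" for D i
  define \<D> where "\<D> = {D. \<forall>J. finite J \<and> J \<subseteq> I \<longrightarrow> card J \<le> card (\<Union>i\<in>J. B D i)}"
  have "\<exists>D\<in>\<D>. \<forall>X\<in>\<D>. D \<subseteq> X \<longrightarrow> X = D"
  proof (rule subset_Zorn_nonempty)
    have "{} \<in> \<D>" using hall by (simp add: \<D>_def B_def)
    then show "\<D> \<noteq> {}" by blast
  next
    fix \<C> assume ne: "\<C> \<noteq> {}" and chain: "subset.chain \<D> \<C>"
    have "card J \<le> card (\<Union>i\<in>J. B (\<Union>\<C>) i)" if J: "finite J" "J \<subseteq> I" for J
    proof -
      \<comment> \<open>The condition for \<open>J\<close> involves only the finitely many pairs of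
        \<open>Sigma J A\<close>, so one member of the chain already makes all relevant
        deletions.\<close>
      have "finite (Sigma J A \<inter> \<Union>\<C>)" using J fin by (intro finite_Int disjI1 finite_SigmaI) auto
      then obtain D where D: "D \<in> \<C>" "Sigma J A \<inter> \<Union>\<C> \<subseteq> D"
        using finite_subset_Union_chain[OF _ _ ne chain] by (metis Int_lower2)
      then have "B (\<Union>\<C>) i = B D i" if "i \<in> J" for i
        using that unfolding B_def by blast
      moreover have "D \<in> \<D>" using D chain by (auto simp: subset_chain_def)
      ultimately show ?thesis using J by (simp add: \<D>_def)
    qed
    then show "\<Union>\<C> \<in> \<D>" by (simp add: \<D>_def)
  qed
  then obtain D where "D \<in> \<D>" and max: "\<And>X. X \<in> \<D> \<Longrightarrow> D \<subseteq> X \<Longrightarrow> X = D" by blast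
  define N where "N J = (\<Union>i\<in>J. B D i)" for J
  have hallD: "card J \<le> card (N J)" if "finite J" "J \<subseteq> I" for J
    using \<open>D \<in> \<D>\<close> that by (simp add: \<D>_def N_def)
  have finB: "finite (B D i)" if "i \<in> I" for i using fin[OF that] by (simp add: B_def)
  have finN: "finite (N J)" if "finite J" "J \<subseteq> I" for J
    using that finB by (auto simp: N_def)
  \<comment> \<open>A family that violates Hall's condition once \<open>x\<close> is deleted must
    contain \<open>i\<close>; \<open>J\<close> is that family without \<open>i\<close>, which turns
    the strict inequality into a weak one.\<close>
  have tight: "\<exists>J. finite J \<and> J \<subseteq> I \<and> i \<notin> J \<and> card (N J \<union> (B D i - {x})) \<le> card J"
    if i: "i \<in> I" and x: "x \<in> B D i" for i x
  proof -
    have "insert (i, x) D \<noteq> D" using x by (auto simp: B_def)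
    then have "insert (i, x) D \<notin> \<D>" using max by blast
    then obtain J where J: "finite J" "J \<subseteq> I" "card (\<Union>j\<in>J. B (insert (i, x) D) j) < card J"
      by (auto simp: \<D>_def not_le)
    have Bi: "B (insert (i, x) D) i = B D i - {x}" by (auto simp: B_def)
    have Bj: "B (insert (i, x) D) j = B D j" if "j \<noteq> i" for j using that by (auto simp: B_def)
    have "i \<in> J"
    proof (rule ccontr)
      assume "i \<notin> J"
      then have "(\<Union>j\<in>J. B (insert (i, x) D) j) = N J"
        unfolding N_def by (intro SUP_cong refl Bj) blast
      with J hallD[of J] show False by simp
    qed
    moreover from this have "(\<Union>j\<in>J. B (insert (i, x) D) j) = N (J - {i}) \<union> (B D i - {x})"
      using Bj by (force simp: N_def Bi)
    ultimately show ?thesis using J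
      by (intro exI[of _ "J - {i}"]) (auto simp: card_Diff_singleton)
  qed
  have unique: "x = y" if i: "i \<in> I" and x: "x \<in> B D i" and y: "y \<in> B D i" for i x y
  proof (rule ccontr)
    assume "x \<noteq> y"
    obtain J where J: "finite J" "J \<subseteq> I" "i \<notin> J" "card (N J \<union> (B D i - {x})) \<le> card J"
      using tight[OF i x] by blast
    obtain K where K: "finite K" "K \<subseteq> I" "i \<notin> K" "card (N K \<union> (B D i - {y})) \<le> card K"
      using tight[OF i y] by blast
    let ?U = "N J \<union> (B D i - {x})" and ?V = "N K \<union> (B D i - {y})"
    have fUV: "finite ?U" "finite ?V" using J K finN finB i by auto
    \<comment> \<open>As \<open>x\<close> and \<open>y\<close> differ, the two reduced copies of
      \<open>B D i\<close> together give all of it. So the union of \<open>?U\<close> and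
      \<open>?V\<close> has at least \<open>card (J \<union> K) + 1\<close> elements and their
      intersection at least \<open>card (J \<inter> K)\<close>, one more in total than tightness
      allows.\<close>
    have "N (insert i (J \<union> K)) = ?U \<union> ?V" using \<open>x \<noteq> y\<close> by (auto simp: N_def)
    then have "card (insert i (J \<union> K)) \<le> card (?U \<union> ?V)"
      using hallD[of "insert i (J \<union> K)"] i J K by simp
    moreover have "card (J \<inter> K) \<le> card (?U \<inter> ?V)"
    proof (rule order.trans[OF hallD])
      show "card (N (J \<inter> K)) \<le> card (?U \<inter> ?V)"
        using fUV by (intro card_mono) (auto simp: N_def)
    qed (use J in auto)
    moreover have "card (insert i (J \<union> K)) = card (J \<union> K) + 1" using J K by simp
    ultimately show False
      using card_Un_Int[OF fUV] card_Un_Int[OF J(1) K(1)] J(4) K(4) by linarith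
  qed
  have "\<exists>y. B D i = {y}" if i: "i \<in> I" for i
  proof -
    have "B D i \<noteq> {}" using hallD[of "{i}"] i by (auto simp: N_def)
    then show ?thesis using unique[OF i] by blast
  qed
  then obtain f where f: "\<And>i. i \<in> I \<Longrightarrow> B D i = {f i}" by metis
  have "inj_on f I"
  proof (rule inj_onI, rule ccontr)
    fix i j assume ij: "i \<in> I" "j \<in> I" "f i = f j" "i \<noteq> j"
    then show False using hallD[of "{i, j}"] by (simp add: N_def f)
  qed
  moreover have "f i \<in> A i" if "i \<in> I" for i using f[OF that] by (auto simp: B_def)
  ultimately show ?thesis by blast
qed

text \<open>If there are no Folner sets, then for a finite set \<open>T\<close> all finite \<open>F\<close> satisfy
  \<open>2 |F| \<le> |T F|\<close>, and the marriage theorem yields two injections of the group into itself with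
  disjoint images that move every point by a factor in \<open>T\<close>.  An invariant measure would give both
  images measure 1.\<close>

theorem amenable_imp_folner:
  fixes G :: "('a, 'b) monoid_scheme"
  assumes G: "group G" and "amenable G" and E: "finite E" "E \<subseteq> carrier G" and "0 < (\<epsilon>::real)"
  shows "\<exists>F. finite F \<and> F \<noteq> {} \<and> F \<subseteq> carrier G \<and>
    (\<forall>g\<in>E. real (card {x \<in> F. g \<otimes>\<^bsub>G\<^esub> x \<notin> F}) \<le> \<epsilon> * card F)"
proof (rule ccontr)
  interpret group G by fact
  assume no: "\<not> ?thesis"
  have bad: "\<exists>g\<in>E. \<epsilon> * card F < real (card {x \<in> F. g \<otimes>\<^bsub>G\<^esub> x \<notin> F})"
    if "finite F" "F \<noteq> {}" "F \<subseteq> carrier G" for F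
    using no that by (meson not_le)
  \<comment> \<open>The identity in \<open>S\<close> makes \<open>F\<close> part of its product with
    \<open>S\<close>, so that the images of points leaving \<open>F\<close> are a net gain.\<close>
  define S where "S = insert \<one>\<^bsub>G\<^esub> E"
  have S: "finite S" "S \<subseteq> carrier G" using E by (auto simp: S_def)
  have set_mult_fin: "finite (X <#>\<^bsub>G\<^esub> Y)" if "finite X" "finite Y" for X Y
    using that by (simp add: set_mult_def)
  have grow: "(1 + \<epsilon>) * card F \<le> card (S <#>\<^bsub>G\<^esub> F)" if F: "finite F" "F \<subseteq> carrier G" for F
  proof (cases "F = {}")
    case False
    then obtain g where g: "g \<in> E" "\<epsilon> * card F < real (card {x \<in> F. g \<otimes>\<^bsub>G\<^esub> x \<notin> F})"
      using bad F by blast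
    let ?M = "{x \<in> F. g \<otimes>\<^bsub>G\<^esub> x \<notin> F}"
    have gG: "g \<in> carrier G" using g E by blast
    have "inj_on ((\<otimes>\<^bsub>G\<^esub>) g) ?M" using inj_on_cmult[OF gG] F(2) by (auto intro: inj_on_subset)
    then have "card F + card ?M = card (F \<union> (\<otimes>\<^bsub>G\<^esub>) g ` ?M)"
      using F(1) by (subst card_Un_disjoint) (auto simp: card_image)
    also have "\<dots> \<le> card (S <#>\<^bsub>G\<^esub> F)"
    proof (rule card_mono[OF set_mult_fin[OF S(1) F(1)]])
      have "x \<in> S <#>\<^bsub>G\<^esub> F" if "x \<in> F" for x
        using that F(2) by (auto simp: set_mult_def S_def intro!: bexI[of _ x])
      moreover have "g \<otimes>\<^bsub>G\<^esub> x \<in> S <#>\<^bsub>G\<^esub> F" if "x \<in> F" for x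
        using that g(1) by (auto simp: set_mult_def S_def)
      ultimately show "F \<union> (\<otimes>\<^bsub>G\<^esub>) g ` ?M \<subseteq> S <#>\<^bsub>G\<^esub> F" by blast
    qed
    finally show ?thesis using g(2) by (simp add: algebra_simps)
  qed simp
  \<comment> \<open>\<open>T k\<close> is the \<open>k\<close>-fold product set of \<open>S\<close>,
    which enlarges every finite set at least by the factor
    \<open>(1 + \<epsilon>) ^ k\<close>.\<close>
  define T where "T k = (((<#>\<^bsub>G\<^esub>) S) ^^ k) {\<one>\<^bsub>G\<^esub>}" for k
  have T: "finite (T k) \<and> T k \<subseteq> carrier G" for k
    by (induction k) (simp_all add: T_def S set_mult_fin set_mult_closed)
  have growT: "(1 + \<epsilon>) ^ k * card F \<le> card (T k <#>\<^bsub>G\<^esub> F)" if F: "finite F" "F \<subseteq> carrier G" for k F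
  proof (induction k)
    case 0
    have "T 0 <#>\<^bsub>G\<^esub> F = F" using F(2) by (force simp: T_def set_mult_def)
    then show ?case by simp
  next
    case (Suc k)
    have "(1 + \<epsilon>) ^ Suc k * card F \<le> (1 + \<epsilon>) * card (T k <#>\<^bsub>G\<^esub> F)"
      using mult_left_mono[OF Suc, of "1 + \<epsilon>"] \<open>0 < \<epsilon>\<close> by (simp add: mult.assoc)
    also have "\<dots> \<le> card (S <#>\<^bsub>G\<^esub> (T k <#>\<^bsub>G\<^esub> F))"
      using T[of k] F by (intro grow set_mult_fin set_mult_closed) auto
    also have "S <#>\<^bsub>G\<^esub> (T k <#>\<^bsub>G\<^esub> F) = T (Suc k) <#>\<^bsub>G\<^esub> F"
      using set_mult_assoc[OF S(2)] T[of k] F(2) by (simp add: T_def)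
    finally show ?case .
  qed
  obtain k where "2 < (1 + \<epsilon>) ^ k" using real_arch_pow[of "1 + \<epsilon>" 2] \<open>0 < \<epsilon>\<close> by auto
  then have double: "2 * card F \<le> card (T k <#>\<^bsub>G\<^esub> F)" if "finite F" "F \<subseteq> carrier G" for F
  proof -
    have "2 * real (card F) \<le> (1 + \<epsilon>) ^ k * card F"
      using \<open>2 < (1 + \<epsilon>) ^ k\<close> by (intro mult_right_mono) auto
    also have "\<dots> \<le> real (card (T k <#>\<^bsub>G\<^esub> F))" by (rule growT[OF that])
    finally show ?thesis by linarith
  qed
  \<comment> \<open>Each group element occurs twice, tagged by a Boolean, so that one injective
    choice yields two injections with disjoint images.\<close>
  define A where "A i = (\<lambda>t. t \<otimes>\<^bsub>G\<^esub> fst i) ` T k" for i :: "'a \<times> bool"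
  have "\<exists>f. inj_on f (carrier G \<times> UNIV) \<and> (\<forall>i\<in>carrier G \<times> UNIV. f i \<in> A i)"
  proof (rule marriage_Rado)
    show "finite (A i)" for i using T by (simp add: A_def)
    fix J :: "('a \<times> bool) set" assume J: "finite J" "J \<subseteq> carrier G \<times> UNIV"
    \<comment> \<open>Forgetting the tag at most halves a set, which the doubling under
      \<open>T k\<close> compensates.\<close>
    have "card J \<le> card (fst ` J \<times> (UNIV :: bool set))"
      using J(1) by (intro card_mono) force+
    also have "\<dots> = 2 * card (fst ` J)" by (simp add: card_cartesian_product)
    also have "\<dots> \<le> card (T k <#>\<^bsub>G\<^esub> fst ` J)" using J by (intro double) auto
    also have "T k <#>\<^bsub>G\<^esub> fst ` J = (\<Union>i\<in>J. A i)" by (auto simp: set_mult_def A_def)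
    finally show "card J \<le> card (\<Union>i\<in>J. A i)" .
  qed
  then obtain f where inj: "inj_on f (carrier G \<times> UNIV)"
    and fA: "\<forall>i\<in>carrier G \<times> UNIV. f i \<in> A i" by (elim exE conjE)
  have f: "f (x, b) \<in> A (x, b)" if "x \<in> carrier G" for x b using fA that by simp
  obtain \<mu> :: "'a set \<Rightarrow> real" where \<mu>: "\<forall>A. A \<subseteq> carrier G \<longrightarrow> 0 \<le> \<mu> A"
      "\<forall>A B. A \<subseteq> carrier G \<and> B \<subseteq> carrier G \<and> A \<inter> B = {} \<longrightarrow> \<mu> (A \<union> B) = \<mu> A + \<mu> B"
      "\<forall>g A. g \<in> carrier G \<and> A \<subseteq> carrier G \<longrightarrow> \<mu> (g <#\<^bsub>G\<^esub> A) = \<mu> A"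
    and one: "\<mu> (carrier G) = 1"
    using \<open>amenable G\<close> unfolding amenable_def by (elim exE conjE)
  have nonneg: "0 \<le> \<mu> X" if "X \<subseteq> carrier G" for X using \<mu>(1) that by simp
  have add: "\<mu> (X \<union> Y) = \<mu> X + \<mu> Y"
    if "X \<subseteq> carrier G" "Y \<subseteq> carrier G" "X \<inter> Y = {}" for X Y
    by (rule \<mu>(2)[rule_format]) (intro conjI that)
  have inv: "\<mu> (g <#\<^bsub>G\<^esub> X) = \<mu> X" if "g \<in> carrier G" "X \<subseteq> carrier G" for g X
    by (rule \<mu>(3)[rule_format]) (intro conjI that)
  have f_carrier: "f (x, b) \<in> carrier G" if "x \<in> carrier G" for x b
    using f[OF that, of b] subsetD[OF conjunct2[OF T]] that by (auto simp: A_def)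
  have f_eq: "x = y \<and> b = c" if "f (x, b) = f (y, c)" "x \<in> carrier G" "y \<in> carrier G" for x y b c
    using inj_onD[OF inj that(1)] that by simp
  have inj_b: "inj_on (\<lambda>x. f (x, b)) (carrier G)" for b
    by (rule inj_onI) (use f_eq in blast)
  \<comment> \<open>Induction on the set of factors. The points with a single factor
    \<open>t\<close> are translated by \<open>t\<close>, which preserves the measure, and points
    with different factors are different by cancellation.\<close>
  have piece: "\<mu> ((\<lambda>x. f (x, b)) ` {x \<in> carrier G. \<exists>t\<in>R. f (x, b) = t \<otimes>\<^bsub>G\<^esub> x}) =
      \<mu> {x \<in> carrier G. \<exists>t\<in>R. f (x, b) = t \<otimes>\<^bsub>G\<^esub> x}" if "finite R" "R \<subseteq> carrier G" for R b
    using that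
  proof (induction R)
    case empty
    then show ?case by simp
  next
    case (insert t R)
    let ?X = "{x \<in> carrier G. \<exists>t\<in>R. f (x, b) = t \<otimes>\<^bsub>G\<^esub> x}"
      and ?Y = "{x \<in> carrier G. f (x, b) = t \<otimes>\<^bsub>G\<^esub> x}"
      and ?Z = "{x \<in> carrier G. \<exists>t\<in>insert t R. f (x, b) = t \<otimes>\<^bsub>G\<^esub> x}"
    have disj: "?X \<inter> ?Y = {}" using insert.hyps insert.prems by (auto simp: subset_iff)
    have "(\<lambda>x. f (x, b)) ` ?Y = t <#\<^bsub>G\<^esub> ?Y" by (auto simp: l_coset_def)
    then have Y: "\<mu> ((\<lambda>x. f (x, b)) ` ?Y) = \<mu> ?Y" using inv insert.prems by auto
    have "\<mu> ((\<lambda>x. f (x, b)) ` ?X \<union> (\<lambda>x. f (x, b)) ` ?Y)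
        = \<mu> ((\<lambda>x. f (x, b)) ` ?X) + \<mu> ((\<lambda>x. f (x, b)) ` ?Y)"
    proof (rule add)
      show "(\<lambda>x. f (x, b)) ` ?X \<inter> (\<lambda>x. f (x, b)) ` ?Y = {}"
        using inj_on_image_Int[OF inj_b, of ?X ?Y b] disj by auto
    qed (use f_carrier in blast)+
    also have "\<dots> = \<mu> ?X + \<mu> ?Y" using insert Y by simp
    also have "\<dots> = \<mu> (?X \<union> ?Y)" using disj by (intro add[symmetric]) auto
    finally have "\<mu> ((\<lambda>x. f (x, b)) ` (?X \<union> ?Y)) = \<mu> (?X \<union> ?Y)" by (simp add: image_Un)
    moreover have "?Z = ?X \<union> ?Y" by auto
    ultimately show ?case by simp
  qed
  have full: "\<mu> ((\<lambda>x. f (x, b)) ` carrier G) = 1" for b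
  proof -
    have "{x \<in> carrier G. \<exists>t\<in>T k. f (x, b) = t \<otimes>\<^bsub>G\<^esub> x} = carrier G"
      using f by (auto simp: A_def)
    then show ?thesis using piece[of "T k" b] T one by simp
  qed
  let ?I = "\<lambda>b. (\<lambda>x. f (x, b)) ` carrier G"
  have I: "?I b \<subseteq> carrier G" for b using f_carrier by auto
  have "?I True \<inter> ?I False = {}" using f_eq by blast
  then have "\<mu> (?I True \<union> ?I False) = 2" using add[of "?I True" "?I False"] I full by simp
  moreover have "\<mu> ((?I True \<union> ?I False) \<union> (carrier G - (?I True \<union> ?I False)))
      = \<mu> (?I True \<union> ?I False) + \<mu> (carrier G - (?I True \<union> ?I False))"
    using I by (intro add) auto
  moreover have "(?I True \<union> ?I False) \<union> (carrier G - (?I True \<union> ?I False)) = carrier G"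
    using I by blast
  ultimately show False
    using one nonneg[of "carrier G - (?I True \<union> ?I False)"] by simp
qed

text \<open>An element acts on the cosets of \<open>N\<close> as left multiplication by its class in
  the quotient, so Folner sets of the quotient are Folner sets of cosets.\<close>

theorem sofic_by_amenable:
  assumes G: "group G" and N: "N \<lhd> G" and "sofic (G\<lparr>carrier := N\<rparr>)" and am: "amenable (G Mod N)"
  shows "sofic G"
proof (rule sofic_of_coset_folner[OF G normal_imp_subgroup[OF N] assms(3)])
  interpret group G by fact
  interpret N: normal N G by fact
  have act: "g <#\<^bsub>G\<^esub> q = (N #>\<^bsub>G\<^esub> g) \<otimes>\<^bsub>G Mod N\<^esub> q"
    if "g \<in> carrier G" and q: "q \<in> carrier (G Mod N)" for g q
  proof -
    obtain a where a: "a \<in> carrier G" "q = N #>\<^bsub>G\<^esub> a" using q by (auto simp: FactGroup_def RCOSETS_def)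
    have "g <#\<^bsub>G\<^esub> q = g <#\<^bsub>G\<^esub> (a <#\<^bsub>G\<^esub> N)" using a N.coset_eq by simp
    also have "\<dots> = (g \<otimes>\<^bsub>G\<^esub> a) <#\<^bsub>G\<^esub> N" using that a N.subset by (simp add: lcos_m_assoc)
    also have "\<dots> = N #>\<^bsub>G\<^esub> (g \<otimes>\<^bsub>G\<^esub> a)" using that a N.coset_eq by simp
    also have "\<dots> = (N #>\<^bsub>G\<^esub> g) \<otimes>\<^bsub>G Mod N\<^esub> q" using that a by (simp add: FactGroup_def N.rcos_sum)
    finally show ?thesis .
  qed
  show "coset_folner G N"
    unfolding coset_folner_def
  proof (intro allI impI, elim conjE)
    fix E :: "'a set" and \<epsilon> :: real
    assume E: "finite E" "E \<subseteq> carrier G" and "0 < \<epsilon>"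
    let ?E = "(\<lambda>g. N #>\<^bsub>G\<^esub> g) ` E"
    have E': "finite ?E" "?E \<subseteq> carrier (G Mod N)" using E by (auto simp: FactGroup_def RCOSETS_def)
    obtain F where F: "finite F" "F \<noteq> {}" "F \<subseteq> carrier (G Mod N)"
      and fol: "\<forall>u\<in>?E. real (card {x \<in> F. u \<otimes>\<^bsub>G Mod N\<^esub> x \<notin> F}) \<le> \<epsilon> * card F"
      using amenable_imp_folner[OF N.factorgroup_is_group am E' \<open>0 < \<epsilon>\<close>] by (elim exE conjE)
    have "real (card {q \<in> F. g <#\<^bsub>G\<^esub> q \<notin> F}) \<le> \<epsilon> * card F" if "g \<in> E" for g
    proof -
      have "{q \<in> F. g <#\<^bsub>G\<^esub> q \<notin> F} = {q \<in> F. (N #>\<^bsub>G\<^esub> g) \<otimes>\<^bsub>G Mod N\<^esub> q \<notin> F}"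
        using act[of g] that E(2) F(3) by (intro Collect_cong conj_cong refl) (simp add: subset_iff)
      then show ?thesis using fol that by simp
    qed
    with F show "\<exists>F. finite F \<and> F \<noteq> {} \<and> F \<subseteq> lcosets\<^bsub>G\<^esub> N \<and>
        (\<forall>g\<in>E. real (card {q \<in> F. g <#\<^bsub>G\<^esub> q \<notin> F}) \<le> \<epsilon> * card F)"
      by (intro exI[of _ F] conjI ballI) (simp_all add: normal_lcosets[OF N])
  qed
qed

section \<open>Minimal non-sofic groups\<close>

text \<open>The approximation conditions for \<open>E\<close> involve only elements of the subgroup
  generated by \<open>E\<close>; all other elements may act as the identity.\<close>

lemma sofic_if_finitely_generated_subgroups_sofic:
  assumes G: "group G"
    and sub: "\<And>S. finite S \<Longrightarrow> S \<subseteq> carrier G \<Longrightarrow> sofic (G\<lparr>carrier := generate G S\<rparr>)"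
  shows "sofic G"
proof (rule soficI_approx[OF G, of "1/2"])
  interpret group G by fact
  fix E :: "'a set" and \<epsilon> :: real
  assume E: "finite E" "E \<subseteq> carrier G" and \<epsilon>: "0 < \<epsilon>"
  let ?H = "generate G E"
  have H: "subgroup ?H G" by (rule generate_is_subgroup[OF E(2)])
  have EH: "E \<subseteq> ?H" by (auto intro: generate.incl)
  have mult: "g \<otimes>\<^bsub>G\<^esub> h \<in> ?H" if "g \<in> E" "h \<in> E" for g h
    using that EH by (intro subgroup.m_closed[OF H]) auto
  obtain n :: nat and s where s: "sofic_approx (G\<lparr>carrier := ?H\<rparr>) E \<epsilon> (1/2) {1..n} s"
    using sofic_imp_approx[OF subgroup_imp_group[OF H] sub[OF E] E(1) _ \<epsilon>] EH by auto
  define X where "X = {1..n}"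
  define t where "t g = (if g \<in> ?H then s g else id)" for g
  have t: "t g = s g" if "g \<in> E" for g using that EH by (auto simp: t_def)
  have tm: "t (g \<otimes>\<^bsub>G\<^esub> h) = s (g \<otimes>\<^bsub>G\<^esub> h)" if "g \<in> E" "h \<in> E" for g h
    using mult[OF that] by (simp add: t_def)
  have "t g permutes X" for g
    using s by (auto simp: t_def sofic_approx_def permutes_id X_def)
  with s[folded X_def] have "sofic_approx G E \<epsilon> (1/2) X t"
    by (simp add: sofic_approx_def t tm)
  then show "\<exists>(n::nat) s. sofic_approx G E \<epsilon> (1/2) {1..n} s" unfolding X_def by blast
qed simp

text \<open>Otherwise every finitely generated subgroup is proper, hence sofic by
  minimality.\<close>

lemma minimal_non_sofic_finitely_generated:
  assumes "minimal_non_sofic G"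
  shows "finitely_generated G"
proof (rule ccontr)
  assume nfg: "\<not> finitely_generated G"
  have G: "group G" using assms by (simp add: minimal_non_sofic_def)
  interpret group G by fact
  have "sofic (G\<lparr>carrier := generate G S\<rparr>)" if "finite S" "S \<subseteq> carrier G" for S
    using assms nfg that generate_is_subgroup[OF that(2)]
    unfolding minimal_non_sofic_def finitely_generated_def by blast
  then have "sofic G" by (rule sofic_if_finitely_generated_subgroups_sofic[OF G])
  then show False using assms by (simp add: minimal_non_sofic_def)
qed

lemma minimal_non_sofic_no_finite_index:
  assumes "minimal_non_sofic G" "subgroup H G" "finite (lcosets\<^bsub>G\<^esub> H)"
  shows "H = carrier G"
proof (rule ccontr)
  assume "H \<noteq> carrier G"
  then have "sofic (G\<lparr>carrier := H\<rparr>)" "group G" "\<not> sofic G"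
    using assms(1,2) by (auto simp: minimal_non_sofic_def)
  then show False using sofic_of_finite_index[OF _ assms(2) _ assms(3)] by simp
qed

section \<open>Finitely generated and simple quotients\<close>

lemma finitely_generated_FactGroup:
  assumes G: "group G" and N: "N \<lhd> G" and "finitely_generated G"
  shows "finitely_generated (G Mod N)"
proof -
  interpret group G by fact
  interpret N: normal N G by fact
  interpret Q: group "G Mod N" by (rule N.factorgroup_is_group)
  interpret h: group_hom G "G Mod N" "\<lambda>a. N #>\<^bsub>G\<^esub> a"
    by unfold_locales (rule N.r_coset_hom_Mod)
  obtain S where S: "finite S" "S \<subseteq> carrier G" "generate G S = carrier G"
    using assms(3) by (auto simp: finitely_generated_def)
  have im: "(\<lambda>a. N #>\<^bsub>G\<^esub> a) ` carrier G = carrier (G Mod N)"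
    by (auto simp: FactGroup_def RCOSETS_def)
  have "generate (G Mod N) ((\<lambda>a. N #>\<^bsub>G\<^esub> a) ` S) = carrier (G Mod N)"
    using h.generate_img[OF S(2)] S(3) im by simp
  moreover have "(\<lambda>a. N #>\<^bsub>G\<^esub> a) ` S \<subseteq> carrier (G Mod N)" using S(2) im by blast
  ultimately show ?thesis unfolding finitely_generated_def using S(1) by blast
qed

text \<open>The preimage of a normal subgroup of the quotient is normal and contains
  \<open>N\<close>, so it is \<open>N\<close> or the whole group.\<close>

lemma maximal_normal_subgroup_FactGroup_simple:
  assumes G: "group G" and max: "maximal_normal_subgroup N G"
  shows "is_simple (G Mod N)"
proof -
  interpret group G by fact
  have N: "N \<lhd> G" "N \<noteq> carrier G" using max by (auto simp: maximal_normal_subgroup_def)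
  interpret N: normal N G by fact
  interpret Q: group "G Mod N" by (rule N.factorgroup_is_group)
  interpret h: group_hom G "G Mod N" "\<lambda>a. N #>\<^bsub>G\<^esub> a"
    by unfold_locales (rule N.r_coset_hom_Mod)
  have im: "(\<lambda>a. N #>\<^bsub>G\<^esub> a) ` carrier G = carrier (G Mod N)"
    by (auto simp: FactGroup_def RCOSETS_def)
  have one: "\<one>\<^bsub>G Mod N\<^esub> = N" by (simp add: FactGroup_def)
  have Nx: "N #>\<^bsub>G\<^esub> x = N \<longleftrightarrow> x \<in> N" if "x \<in> carrier G" for x
    using coset_join1[OF _ that N.subgroup_axioms] coset_join2[OF that N.subgroup_axioms] by metis
  have "carrier (G Mod N) \<noteq> {N}"
  proof
    assume "carrier (G Mod N) = {N}"
    with im have "N #>\<^bsub>G\<^esub> x = N" if "x \<in> carrier G" for x using that by auto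
    with Nx have "carrier G \<subseteq> N" by auto
    then show False using N(2) N.subset by simp
  qed
  moreover have "K = carrier (G Mod N) \<or> K = {N}" if K: "K \<lhd> G Mod N" for K
  proof -
    interpret K: normal K "G Mod N" by fact
    let ?P = "{x \<in> carrier G. N #>\<^bsub>G\<^esub> x \<in> K}"
    have "subgroup ?P G"
      using K.m_closed K.m_inv_closed K.one_closed by (intro subgroupI) (auto simp: h.hom_mult h.hom_inv)
    then have "?P \<lhd> G"
      using K.inv_op_closed2 by (intro normal_invI) (auto simp: h.hom_mult h.hom_inv h.hom_closed)
    moreover have "N \<subseteq> ?P"
    proof
      fix x assume x: "x \<in> N"
      then have "x \<in> carrier G" using N.subset by auto
      with Nx[OF this] x show "x \<in> ?P" using K.one_closed by (simp add: one)
    qed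
    ultimately have "?P = carrier G \<or> ?P = N"
      using max unfolding maximal_normal_subgroup_def by blast
    moreover have "K = (\<lambda>a. N #>\<^bsub>G\<^esub> a) ` ?P" using K.subset unfolding im[symmetric] by auto
    moreover have "(\<lambda>a. N #>\<^bsub>G\<^esub> a) ` N = (\<lambda>a. N) ` N"
      using Nx N.subset by (intro image_cong) auto
    then have "(\<lambda>a. N #>\<^bsub>G\<^esub> a) ` N = {N}" using N.one_closed by (simp add: image_constant)
    ultimately show ?thesis using im by auto
  qed
  ultimately show ?thesis
    unfolding is_simple_def one using Q.group_axioms by blast
qed

text \<open>Zorn's lemma applies since the union of a chain of proper subgroups stays proper: a
  finite generating set inside the union would lie in one member of the chain.\<close>

lemma maximal_normal_subgroup_exists:
  assumes G: "group G" and fg: "finitely_generated G" and N: "N \<lhd> G" "N \<noteq> carrier G"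
  shows "\<exists>L. maximal_normal_subgroup L G \<and> N \<subseteq> L"
proof -
  interpret group G by fact
  obtain S where S: "finite S" "S \<subseteq> carrier G" "generate G S = carrier G"
    using fg by (auto simp: finitely_generated_def)
  let ?\<N> = "{K. K \<lhd> G \<and> K \<noteq> carrier G \<and> N \<subseteq> K}"
  have "\<exists>L\<in>?\<N>. \<forall>X\<in>?\<N>. L \<subseteq> X \<longrightarrow> X = L"
  proof (rule subset_Zorn_nonempty)
    show "?\<N> \<noteq> {}" using N by blast
  next
    fix \<C> assume ne: "\<C> \<noteq> {}" and chain: "subset.chain ?\<N> \<C>"
    have mem: "K \<lhd> G" "K \<noteq> carrier G" "N \<subseteq> K" if "K \<in> \<C>" for K
      using chain that by (auto simp: subset_chain_def)
    have sg: "subgroup K G" if "K \<in> \<C>" for K using normal_imp_subgroup[OF mem(1)[OF that]] .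
    have lin: "X \<subseteq> Y \<or> Y \<subseteq> X" if "X \<in> \<C>" "Y \<in> \<C>" for X Y
      using chain that by (auto simp: subset_chain_def)
    have "subgroup (\<Union>\<C>) G"
    proof (rule subgroupI)
      show "\<Union>\<C> \<subseteq> carrier G" using subgroup.subset[OF sg] by (rule Union_least)
      obtain K where "K \<in> \<C>" using ne by auto
      then show "\<Union>\<C> \<noteq> {}" using subgroup.one_closed[OF sg] by auto
    next
      fix a assume "a \<in> \<Union>\<C>"
      then obtain X where "X \<in> \<C>" "a \<in> X" by (rule UnionE)
      then show "inv\<^bsub>G\<^esub> a \<in> \<Union>\<C>" using subgroup.m_inv_closed[OF sg] by (intro UnionI)
    next
      fix a b assume "a \<in> \<Union>\<C>" "b \<in> \<Union>\<C>"
      then obtain X where "X \<in> \<C>" "a \<in> X" "b \<in> X" using lin by blast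
      then show "a \<otimes>\<^bsub>G\<^esub> b \<in> \<Union>\<C>" using subgroup.m_closed[OF sg] by (intro UnionI)
    qed
    then have "\<Union>\<C> \<lhd> G" using normal_invE(2)[OF mem(1)] by (intro normal_invI) auto
    moreover have "\<Union>\<C> \<noteq> carrier G"
    proof
      assume "\<Union>\<C> = carrier G"
      then obtain K where K: "K \<in> \<C>" "S \<subseteq> K"
        using finite_subset_Union_chain[OF S(1) _ ne chain] S(2) by metis
      then have "carrier G \<subseteq> K" using generate_subgroup_incl[OF _ sg] S(3) by blast
      then show False using mem(2)[OF K(1)] subgroup.subset[OF sg[OF K(1)]] by blast
    qed
    moreover have "N \<subseteq> \<Union>\<C>" using ne mem(3) by blast
    ultimately show "\<Union>\<C> \<in> ?\<N>" by blast
  qed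
  then obtain L where LN: "L \<in> ?\<N>" and maxL: "\<forall>X\<in>?\<N>. L \<subseteq> X \<longrightarrow> X = L" by (rule bexE)
  have L: "L \<lhd> G" "L \<noteq> carrier G" "N \<subseteq> L" using LN by simp_all
  have max: "X = L" if "X \<lhd> G" "X \<noteq> carrier G" "N \<subseteq> X" "L \<subseteq> X" for X
    using bspec[OF maxL, of X] that by simp
  have "maximal_normal_subgroup L G"
    unfolding maximal_normal_subgroup_def using L max order.trans[OF L(3)] by simp
  with L show ?thesis by auto
qed

text \<open>All subgroups are normal, so any nontrivial \<open>a\<close> generates. If
  \<open>a\<close> had infinite order, its square would generate a proper nontrivial
  subgroup.\<close>

lemma simple_comm_group_finite:
  assumes A: "comm_group A" and simple: "is_simple A"
  shows "finite (carrier A)"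
proof -
  interpret comm_group A by fact
  have sub: "H = carrier A \<or> H = {\<one>\<^bsub>A\<^esub>}" if "subgroup H A" for H
    using simple subgroup_imp_normal[OF that] by (simp add: is_simple_def)
  obtain a where a: "a \<in> carrier A" "a \<noteq> \<one>\<^bsub>A\<^esub>"
    using simple one_closed unfolding is_simple_def by blast
  let ?b = "a [^]\<^bsub>A\<^esub> (2::int)"
  have b: "?b \<in> carrier A" using a by simp
  have "ord a \<noteq> 0"
  proof
    assume "ord a = 0"
    then have free: "i = 0" if "a [^]\<^bsub>A\<^esub> i = \<one>\<^bsub>A\<^esub>" for i :: int
      using int_pow_eq_id[OF a(1)] that by simp
    then have "?b \<noteq> \<one>\<^bsub>A\<^esub>" by fastforce
    moreover have "?b \<in> generate A {?b}" by (rule generate.incl) simp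
    ultimately have "generate A {?b} = carrier A"
      using sub[OF generate_is_subgroup] b by blast
    then obtain k :: int where "a = ?b [^]\<^bsub>A\<^esub> k"
      using a(1) generate_pow[OF b] by blast
    then have "a [^]\<^bsub>A\<^esub> (2 * k - 1) = \<one>\<^bsub>A\<^esub>"
      using a(1) by (simp add: int_pow_diff int_pow_pow)
    then have "2 * k - 1 = 0" by (rule free)
    then show False by presburger
  qed
  moreover have "a \<in> generate A {a}" by (rule generate.incl) simp
  then have "generate A {a} = carrier A"
    using sub[OF generate_is_subgroup, of "{a}"] a by blast
  \<comment> \<open>\<open>ord a = 0\<close> encodes infinite order and \<open>card\<close> is 0 on
    infinite sets, so a nonzero value gives finiteness.\<close>
  ultimately have "card (carrier A) \<noteq> 0" using generate_pow_card[OF a(1)] by simp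
  then show ?thesis by (simp add: card_eq_0_iff)
qed

section \<open>Abelian quotients and perfectness\<close>

lemma FactGroup_comm_group:
  assumes G: "group G" and L: "L \<lhd> G" and der: "derived G (carrier G) \<subseteq> L"
  shows "comm_group (G Mod L)"
proof -
  interpret group G by fact
  interpret L: normal L G by fact
  show ?thesis
  proof (rule group.group_comm_groupI[OF L.factorgroup_is_group])
    fix U V assume "U \<in> carrier (G Mod L)" "V \<in> carrier (G Mod L)"
    then obtain a b where a: "a \<in> carrier G" "U = L #>\<^bsub>G\<^esub> a" and b: "b \<in> carrier G" "V = L #>\<^bsub>G\<^esub> b"
      by (auto simp: FactGroup_def RCOSETS_def)
    have "a \<otimes>\<^bsub>G\<^esub> b \<otimes>\<^bsub>G\<^esub> inv\<^bsub>G\<^esub> a \<otimes>\<^bsub>G\<^esub> inv\<^bsub>G\<^esub> b \<in> L"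
      using a(1) b(1) der unfolding derived_def by (blast intro: generate.incl)
    then have "a \<otimes>\<^bsub>G\<^esub> b \<otimes>\<^bsub>G\<^esub> inv\<^bsub>G\<^esub> (b \<otimes>\<^bsub>G\<^esub> a) \<in> L"
      using a(1) b(1) by (simp add: inv_mult_group m_assoc)
    then have "a \<otimes>\<^bsub>G\<^esub> b \<in> L #>\<^bsub>G\<^esub> (b \<otimes>\<^bsub>G\<^esub> a)"
      using L.rcos_module[OF G, of "b \<otimes>\<^bsub>G\<^esub> a" "a \<otimes>\<^bsub>G\<^esub> b"] a(1) b(1) by simp
    then have "L #>\<^bsub>G\<^esub> (b \<otimes>\<^bsub>G\<^esub> a) = L #>\<^bsub>G\<^esub> (a \<otimes>\<^bsub>G\<^esub> b)"
      using repr_independence[OF _ _ L.subgroup_axioms] a(1) b(1) by simp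
    then show "U \<otimes>\<^bsub>G Mod L\<^esub> V = V \<otimes>\<^bsub>G Mod L\<^esub> U"
      using a b by (simp add: FactGroup_def L.rcos_sum)
  qed
qed

theorem minimal_non_sofic_perfect:
  assumes min: "minimal_non_sofic G"
  shows "derived G (carrier G) = carrier G"
proof (rule ccontr)
  assume ne: "derived G (carrier G) \<noteq> carrier G"
  have G: "group G" using min by (simp add: minimal_non_sofic_def)
  interpret group G by fact
  obtain L where L: "maximal_normal_subgroup L G" "derived G (carrier G) \<subseteq> L"
    using maximal_normal_subgroup_exists[OF G minimal_non_sofic_finitely_generated[OF min]
        derived_self_is_normal ne] by blast
  then have nL: "L \<lhd> G" "L \<noteq> carrier G" by (auto simp: maximal_normal_subgroup_def)
  have "finite (carrier (G Mod L))"
    using simple_comm_group_finite[OF FactGroup_comm_group[OF G nL(1) L(2)]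
        maximal_normal_subgroup_FactGroup_simple[OF G L(1)]] .
  then show False
    using minimal_non_sofic_no_finite_index[OF min normal_imp_subgroup[OF nL(1)]] nL
    by (simp add: normal_lcosets)
qed

section \<open>Conjugation on finite quotients of a normal subgroup\<close>

lemma finite_image_factor:
  assumes "finite (g ` A)" "\<And>x y. x \<in> A \<Longrightarrow> y \<in> A \<Longrightarrow> g x = g y \<Longrightarrow> f x = f y"
  shows "finite (f ` A)"
proof -
  \<comment> \<open>On \<open>A\<close> the function \<open>f\<close> factors through
    \<open>g\<close>: any preimage of \<open>g x\<close> in \<open>A\<close> gives the same value of
    \<open>f\<close>.\<close>
  have "f x = f (inv_into A g (g x))" if "x \<in> A" for x
    using that by (intro assms(2)) (auto simp: inv_into_into f_inv_into_f)
  then have "f ` A = (\<lambda>z. f (inv_into A g z)) ` (g ` A)"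
    unfolding image_image by (rule image_cong[OF refl])
  then show ?thesis by (simp only: finite_imageI assms(1))
qed

text \<open>The conjugates of the quotient map \<open>M \<rightarrow> M/N\<close> are homomorphisms into a finite group, hence
  determined by their values on a finite generating set of \<open>M\<close>, so that there are finitely many
  of them.  The subgroup is the stabilizer of the quotient map.\<close>

lemma conjugation_stabilizer_finite_index:
  fixes G (structure)
  assumes G: "group G" and M: "M \<lhd> G" and fg: "finitely_generated (G\<lparr>carrier := M\<rparr>)"
    and N: "N \<lhd> G\<lparr>carrier := M\<rparr>" and fin: "finite (carrier (G\<lparr>carrier := M\<rparr> Mod N))"
  defines "C \<equiv> {c \<in> carrier G. \<forall>m\<in>M. N #> (inv c \<otimes> m \<otimes> c) = N #> m}"
  shows "subgroup C G" "finite (lcosets C)"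
proof -
  interpret group G by fact
  interpret M: normal M G by fact
  let ?K = "G\<lparr>carrier := M\<rparr>"
  interpret K: group ?K by (rule subgroup_imp_group[OF M.subgroup_axioms])
  interpret N: normal N ?K by fact
  interpret Q: group "?K Mod N" by (rule N.factorgroup_is_group)
  have coset: "N #>\<^bsub>?K\<^esub> m = N #> m" for m by (simp add: r_coset_def)
  have conj: "inv c \<otimes> m \<otimes> c \<in> M" "c \<otimes> m \<otimes> inv c \<in> M" if "c \<in> carrier G" "m \<in> M" for c m
    using that M.inv_op_closed1 M.inv_op_closed2 by auto
  have Mc: "m \<in> carrier G" if "m \<in> M" for m using that M.subset by blast
  have conj_mult: "inv (c \<otimes> d) \<otimes> m \<otimes> (c \<otimes> d) = inv d \<otimes> (inv c \<otimes> m \<otimes> c) \<otimes> d"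
    if "c \<in> carrier G" "d \<in> carrier G" "m \<in> M" for c d m
    using that Mc by (simp add: inv_mult_group m_assoc)
  show C: "subgroup C G"
  proof (rule subgroupI)
    show "C \<subseteq> carrier G" by (auto simp: C_def)
    have "\<one> \<in> C" using Mc by (simp add: C_def)
    then show "C \<noteq> {}" by blast
  next
    fix c assume c: "c \<in> C"
    then have cG: "c \<in> carrier G" by (simp add: C_def)
    have "N #> (inv (inv c) \<otimes> m \<otimes> inv c) = N #> m" if m: "m \<in> M" for m
    proof -
      have "N #> (inv c \<otimes> (c \<otimes> m \<otimes> inv c) \<otimes> c) = N #> (c \<otimes> m \<otimes> inv c)"
        using c conj(2)[OF cG m] by (simp add: C_def)
      moreover have "inv c \<otimes> (c \<otimes> m \<otimes> inv c) \<otimes> c = m"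
        using conj_mult[of "inv c" c m] cG m Mc by simp
      ultimately show ?thesis using cG by simp
    qed
    then show "inv c \<in> C" using cG by (simp add: C_def)
  next
    fix c d assume cd: "c \<in> C" "d \<in> C"
    then have "c \<in> carrier G" "d \<in> carrier G" by (auto simp: C_def)
    with cd conj_mult conj show "c \<otimes> d \<in> C" by (auto simp: C_def)
  qed
  obtain S where S: "finite S" "S \<subseteq> M" "generate ?K S = M"
    using fg by (auto simp: finitely_generated_def)
  \<comment> \<open>\<open>\<phi> d\<close> is the conjugate of the quotient map by
    \<open>d\<close>; \<open>C\<close> consists of the \<open>d\<close> for which it is the quotient
    map itself.\<close>
  define \<phi> where "\<phi> d m = N #> (inv d \<otimes> m \<otimes> d)" for d m
  have hom: "group_hom ?K (?K Mod N) (\<phi> d)" if d: "d \<in> carrier G" for d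
  proof (unfold_locales, rule homI)
    show "\<phi> d m \<in> carrier (?K Mod N)" if "m \<in> carrier ?K" for m
      using conj(1)[OF d] that by (auto simp: \<phi>_def FactGroup_def RCOSETS_def coset)
    fix m m' assume m: "m \<in> carrier ?K" "m' \<in> carrier ?K"
    have "inv d \<otimes> (m \<otimes> m') \<otimes> d = (inv d \<otimes> m \<otimes> d) \<otimes> (inv d \<otimes> m' \<otimes> d)"
      using d m Mc by (simp add: m_assoc inv_solve_left flip: m_assoc[of d "inv d"])
    moreover have "(N #>\<^bsub>?K\<^esub> (inv d \<otimes> m \<otimes> d)) <#>\<^bsub>?K\<^esub> (N #>\<^bsub>?K\<^esub> (inv d \<otimes> m' \<otimes> d))
        = N #>\<^bsub>?K\<^esub> ((inv d \<otimes> m \<otimes> d) \<otimes>\<^bsub>?K\<^esub> (inv d \<otimes> m' \<otimes> d))"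
      using conj(1)[OF d] m by (intro N.rcos_sum) auto
    ultimately show "\<phi> d (m \<otimes>\<^bsub>?K\<^esub> m') = \<phi> d m \<otimes>\<^bsub>?K Mod N\<^esub> \<phi> d m'"
      by (simp add: \<phi>_def FactGroup_def coset)
  qed
  \<comment> \<open>The values of \<open>\<phi> d\<close> on the generators determine
    \<open>\<phi> d\<close>, which in turn determines the coset of \<open>d\<close>.\<close>
  have same_coset: "d <# C = e <# C"
    if d: "d \<in> carrier G" and e: "e \<in> carrier G"
      and eq: "restrict (\<phi> d) S = restrict (\<phi> e) S" for d e
  proof -
    interpret d: group_hom ?K "?K Mod N" "\<phi> d" by (rule hom[OF d])
    interpret e: group_hom ?K "?K Mod N" "\<phi> e" by (rule hom[OF e])
    have "\<phi> d m = \<phi> e m" if "m \<in> generate ?K S" for m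
      using that
    proof (induction rule: generate.induct)
      case one
      then show ?case using d.hom_one e.hom_one by simp
    next
      case (incl h)
      then show ?case using fun_cong[OF eq, of h] by simp
    next
      case (inv h)
      then have "\<phi> d h = \<phi> e h" "h \<in> carrier ?K" using fun_cong[OF eq, of h] S(2) by auto
      then show ?case using d.hom_inv e.hom_inv by simp
    next
      case (eng h1 h2)
      then have "h1 \<in> carrier ?K" "h2 \<in> carrier ?K" using S(3) by auto
      then show ?case using eng d.hom_mult e.hom_mult by simp
    qed
    then have eqM: "\<phi> d m = \<phi> e m" if "m \<in> M" for m using that S(3) by blast
    have "inv d \<otimes> e \<in> C"
      unfolding C_def
    proof (intro CollectI conjI ballI)
      show "inv d \<otimes> e \<in> carrier G" using d e by simp
      fix m assume m: "m \<in> M"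
      \<comment> \<open>The agreement of \<open>\<phi> d\<close> and \<open>\<phi> e\<close> is used
        at \<open>d \<otimes> m \<otimes> inv d\<close>, where \<open>\<phi> d\<close> gives back
        the coset of \<open>m\<close>.\<close>
      have "N #> (inv (inv d \<otimes> e) \<otimes> m \<otimes> (inv d \<otimes> e)) = \<phi> e (d \<otimes> m \<otimes> inv d)"
        using conj_mult[of "inv d" e m] d e m by (simp add: \<phi>_def)
      also have "\<dots> = \<phi> d (d \<otimes> m \<otimes> inv d)" using eqM conj(2)[OF d m] by simp
      also have "\<dots> = N #> m"
        using conj_mult[of "inv d" d m] d m Mc by (simp add: \<phi>_def)
      finally show "N #> (inv (inv d \<otimes> e) \<otimes> m \<otimes> (inv d \<otimes> e)) = N #> m" .
    qed
    then have "e \<in> d <# C" using subgroup.lcos_module_rev[OF C G d e] by simp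
    then show ?thesis using l_repr_independence[OF _ d C] by simp
  qed
  \<comment> \<open>Restriction to \<open>S\<close> makes the functions extensional, so they lie in
    a finite function space.\<close>
  have "(\<lambda>d. restrict (\<phi> d) S) ` carrier G \<subseteq> S \<rightarrow>\<^sub>E carrier (?K Mod N)"
    using S(2) group_hom.hom_closed[OF hom] by auto
  then have "finite ((\<lambda>d. restrict (\<phi> d) S) ` carrier G)"
    by (rule finite_subset) (intro finite_PiE S(1) fin)
  then have "finite ((\<lambda>d. d <# C) ` carrier G)"
    by (rule finite_image_factor) (rule same_coset)
  moreover have "lcosets C = (\<lambda>d. d <# C) ` carrier G" by (auto simp: LCOSETS_def)
  ultimately show "finite (lcosets C)" by simp
qed

theorem minimal_non_sofic_residually_finite_normal_central:
  fixes G (structure)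
  assumes min: "minimal_non_sofic G" and M: "M \<lhd> G"
    and rf: "residually_finite (G\<lparr>carrier := M\<rparr>)" and fg: "finitely_generated (G\<lparr>carrier := M\<rparr>)"
  shows "M \<subseteq> center G"
proof -
  have G: "group G" using min by (simp add: minimal_non_sofic_def)
  interpret group G by fact
  interpret M: normal M G by fact
  have "m \<otimes> g = g \<otimes> m" if m: "m \<in> M" and g: "g \<in> carrier G" for m g
  proof -
    let ?K = "G\<lparr>carrier := M\<rparr>"
    have mG: "m \<in> carrier G" using m M.subset by blast
    have conj: "inv g \<otimes> m \<otimes> g \<in> M" using M.inv_op_closed1[OF g m] .
    \<comment> \<open>\<open>x\<close> is the commutator that has to vanish; it lies in
      \<open>M\<close>, where residual finiteness can detect it.\<close>
    define x where "x = inv g \<otimes> m \<otimes> g \<otimes> inv m"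
    have x: "x \<in> M" using conj m by (simp add: x_def)
    have "x = \<one>"
    proof (rule ccontr)
      assume "x \<noteq> \<one>"
      then obtain N where N: "N \<lhd> ?K" "finite (carrier (?K Mod N))" and xN: "x \<notin> N"
        using rf x unfolding residually_finite_def by auto
      interpret N: normal N ?K by fact
      have sN: "subgroup N G" using incl_subgroup[OF M.subgroup_axioms N.subgroup_axioms] .
      \<comment> \<open>\<open>N\<close> is given as normal only in \<open>M\<close>, but its cosets
        in \<open>M\<close> are preserved under conjugation by a subgroup of finite index, which by
        minimality is all of \<open>G\<close>.\<close>
      have "{c \<in> carrier G. \<forall>m\<in>M. N #> (inv c \<otimes> m \<otimes> c) = N #> m} = carrier G"
        using minimal_non_sofic_no_finite_index[OF min]
          conjugation_stabilizer_finite_index[OF G M fg N] by blast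
      then have "N #> (inv g \<otimes> m \<otimes> g) = N #> m" using g m by blast
      then have "inv g \<otimes> m \<otimes> g \<in> N #> m"
        using rcos_self[OF _ sN, of "inv g \<otimes> m \<otimes> g"] g mG by simp
      then have "x \<in> N" unfolding x_def by (rule subgroup.rcos_module_imp[OF sN G mG])
      with xN show False by blast
    qed
    then have "inv g \<otimes> m \<otimes> g = m" using g mG by (simp add: x_def inv_equality inv_solve_right')
    then have "inv g \<otimes> m \<otimes> g = m"
      using g mG inv_equality[of "inv g \<otimes> m \<otimes> g" "inv m"] by (simp add: x_def)
    then have "g \<otimes> (inv g \<otimes> (m \<otimes> g)) = g \<otimes> m" using g mG by (simp add: m_assoc)
    then show ?thesis using g mG by (simp flip: m_assoc)
  qed
  then show ?thesis using M.subset by (auto simp: center_def)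
qed

theorem theorem1p12:
  fixes G :: "('a, 'b) monoid_scheme" and M :: "'a set"
  assumes "minimal_non_sofic G"
    and "maximal_normal_subgroup M G"
    and "residually_finite (G\<lparr>carrier := M\<rparr>)"
    and "finitely_generated (G\<lparr>carrier := M\<rparr>)"
  shows "M \<subseteq> center G
    \<and> derived G (carrier G) = carrier G
    \<and> finitely_generated (G Mod M)
    \<and> \<not> amenable (G Mod M)
    \<and> is_simple (G Mod M)"
proof -
  have G: "group G" and ns: "\<not> sofic G" using assms(1) by (auto simp: minimal_non_sofic_def)
  have M: "M \<lhd> G" "M \<noteq> carrier G" using assms(2) by (auto simp: maximal_normal_subgroup_def)
  then have "sofic (G\<lparr>carrier := M\<rparr>)"
    using assms(1) normal_imp_subgroup unfolding minimal_non_sofic_def by blast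
  then have "\<not> amenable (G Mod M)" using sofic_by_amenable[OF G M(1)] ns by blast
  then show ?thesis
    using minimal_non_sofic_residually_finite_normal_central[OF assms(1) M(1) assms(3,4)]
      minimal_non_sofic_perfect[OF assms(1)]
      finitely_generated_FactGroup[OF G M(1) minimal_non_sofic_finitely_generated[OF assms(1)]]
      maximal_normal_subgroup_FactGroup_simple[OF G assms(2)]
    by blast
qed

end
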